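(* For every odd integer $n\geq 9$, $R(S_n(2,1),W_8)=R(S_n(3),W_8)=2n-1$.
   Context: All graphs are finite, simple, undirected. For graphs $G,H$, the Ramsey number $R(G,H)$ is the smallest positive integer $N$ such that for every graph $F$ on $N$ vertices, either $F$ contains a subgraph isomorphic to $G$ or the complement $\overline{F}$ contains a subgraph isomorphic to $H$. $W_8$ is the wheel on 9 vertices: a cycle $C_8$ plus one vertex adjacent to all its vertices. $S_k$ denotes the star on $k$ vertices. $S_n(2,1)$ denotes the tree of order $n$ obtained from the star $S_{n-2}$ by subdividing each of two chosen edges once. $S_n(3)$ denotes the tree of order $n$ obtained from the stars $S_3$ (path on 3 vertices, center the middle vertex) and $S_{n-3}$ by adding an edge joining their centers. *)

theory Defs
  imports "Graph_Theory.Graph_Theory"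
begin

text \<open>Finite simple undirected graphs are the symmetric loop-free pair digraphs of locale
  \<^locale>\<open>pair_graph\<close>: an undirected edge is represented by its two opposite arcs.\<close>

definition complement_graph :: "'a pair_pre_digraph \<Rightarrow> 'a pair_pre_digraph" where
  "complement_graph G =
     \<lparr> pverts = pverts G,
       parcs = {(u, v). u \<in> pverts G \<and> v \<in> pverts G \<and> u \<noteq> v \<and> (u, v) \<notin> parcs G} \<rparr>"

text \<open>Subgraphs need not be induced.\<close>

definition contains_copy :: "'a pair_pre_digraph \<Rightarrow> 'b pair_pre_digraph \<Rightarrow> bool" where
  "contains_copy F G \<longleftrightarrow>
     (\<exists>K. pair_graph K \<and> subgraph (with_proj K) (with_proj F) \<and>
          digraph_iso (with_proj G) (with_proj K))"

text \<open>Every finite graph is isomorphic to one whose vertices are natural numbers, so it is enough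
  to let \<open>F\<close> range over graphs on arbitrary \<open>N\<close>-element sets of naturals.\<close>

definition ramsey_number :: "'a pair_pre_digraph \<Rightarrow> 'b pair_pre_digraph \<Rightarrow> nat" where
  "ramsey_number G H =
     (LEAST N. N > 0 \<and>
        (\<forall>F :: nat pair_pre_digraph. pair_graph F \<and> card (pverts F) = N \<longrightarrow>
           contains_copy F G \<or> contains_copy (complement_graph F) H))"

definition star_on :: "'a \<Rightarrow> 'a set \<Rightarrow> 'a pair_pre_digraph" where
  "star_on c L = \<lparr> pverts = insert c L, parcs = {c} \<times> L \<union> L \<times> {c} \<rparr>"

definition join_by_edge ::
    "'a pair_pre_digraph \<Rightarrow> 'a \<Rightarrow> 'a pair_pre_digraph \<Rightarrow> 'a \<Rightarrow> 'a pair_pre_digraph" where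
  "join_by_edge G u H v =
     \<lparr> pverts = pverts G \<union> pverts H, parcs = parcs G \<union> parcs H \<union> {(u, v), (v, u)} \<rparr>"

text \<open>The star on \<open>k\<close> vertices (not \<open>k\<close> leaves), for \<open>k \<ge> 1\<close>, with centre \<open>0\<close>.\<close>

definition star_graph :: "nat \<Rightarrow> nat pair_pre_digraph" where
  "star_graph k = star_on 0 {1..<k}"

text \<open>The tree \<open>S\<^sub>n(2,1)\<close>, for \<open>n \<ge> 5\<close>: the edges \<open>{0,1}\<close> and \<open>{0,2}\<close> of the star on
  \<open>{0..<n-2}\<close> are subdivided by the new vertices \<open>n-2\<close> and \<open>n-1\<close>. The choice of the two edges
  does not matter up to isomorphism.\<close>

definition S_two_one :: "nat \<Rightarrow> nat pair_pre_digraph" where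
  "S_two_one n = subdivide (subdivide (star_graph (n - 2)) (0, 1) (n - 2)) (0, 2) (n - 1)"

text \<open>The tree \<open>S\<^sub>n(3)\<close>, for \<open>n \<ge> 4\<close>: the star on \<open>{0..<n-3}\<close> with centre \<open>0\<close> and the star on
  \<open>{n-3, n-2, n-1}\<close> with centre \<open>n-3\<close>, their centres joined by an edge.\<close>

definition S_three :: "nat \<Rightarrow> nat pair_pre_digraph" where
  "S_three n = join_by_edge (star_graph (n - 3)) 0 (star_on (n - 3) {n - 2, n - 1}) (n - 3)"

definition cycle_graph :: "nat \<Rightarrow> nat pair_pre_digraph" where
  "cycle_graph m =
     \<lparr> pverts = {..<m},
       parcs = {(i, j). i < m \<and> j < m \<and> (j = (i + 1) mod m \<or> i = (j + 1) mod m)} \<rparr>"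

text \<open>The wheel on \<open>m + 1\<close> vertices, for \<open>m \<ge> 3\<close>; its hub is the vertex \<open>m\<close>.\<close>

definition wheel_graph :: "nat \<Rightarrow> nat pair_pre_digraph" where
  "wheel_graph m =
     \<lparr> pverts = insert m (pverts (cycle_graph m)),
       parcs = parcs (cycle_graph m) \<union> parcs (star_on m (pverts (cycle_graph m))) \<rparr>"

end

theory Submission
  imports Defs
begin

text \<open>For the lower bound, two disjoint cliques with at most \<open>n - 1\<close> vertices each contain no
  connected graph on \<open>n\<close> vertices, and the complement is bipartite.

  For the upper bound, let \<open>G\<close> have \<open>2n - 1 = 2k + 1\<close> vertices, and let its complement \<open>H\<close> contain
  no \<open>W\<^sub>8\<close>. If all degrees in \<open>G\<close> were at most \<open>n - 4\<close>, all degrees in \<open>H\<close> would be at least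
  \<open>k + 3\<close>. Call the number of common neighbours of the ends of an edge of \<open>H\<close> its codegree; it is at
  least \<open>5\<close>. A longest-path argument in the common neighbourhood excludes all codegrees from \<open>6\<close> to
  \<open>k - 1\<close>. The codegrees of a triangle add up to at least \<open>k + 8\<close>, so every triangle has an edge of
  codegree at least \<open>k\<close>. At a vertex with an edge of codegree \<open>5\<close>, at most three edges have codegree at
  least \<open>k\<close>; the neighbourhood of such a vertex is rigid enough to exhibit an 8-cycle. If all
  codegrees are at least \<open>k\<close>, the neighbourhood of a vertex of minimum degree contains an 8-cycle.

  So some \<open>v\<close> has degree at least \<open>n - 3\<close> in \<open>G\<close>. If \<open>G\<close> does not contain the tree, few edges of \<open>G\<close>
  leave the neighbourhood of \<open>v\<close>. Hence, unless \<open>H\<close> has a wheel with its hub in that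
  neighbourhood, there are \<open>n\<close> vertices \<open>S\<close>, not adjacent to \<open>v\<close> in \<open>G\<close>, joined
  almost completely in \<open>H\<close> to \<open>v\<close> and its neighbours. As \<open>n\<close> is odd, the subgraph of \<open>G\<close> induced
  by \<open>S\<close> is not regular of degree \<open>n - 4\<close>, and since it does not contain the tree, some \<open>r \<in> S\<close> has four
  \<open>H\<close>-neighbours in \<open>S\<close>; these and four vertices near \<open>v\<close> form the rim of a wheel with hub \<open>r\<close>.\<close>

section \<open>Paths on seven vertices\<close>

lemma ex_distinct_list:
  assumes "n \<le> card S"
  shows "\<exists>zs. length zs = n \<and> distinct zs \<and> set zs \<subseteq> S"
proof -
  obtain T where T: "T \<subseteq> S" "card T = n" "finite T"
    using obtain_subset_with_card_n[OF assms] by blast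
  obtain zs where "set zs = T" "distinct zs" using finite_distinct_list[OF T(3)] by blast
  then show ?thesis using T distinct_card by fastforce
qed

lemma list_of_length:
  "length zs = 3 \<Longrightarrow> \<exists>a b c. zs = [a,b,c]"
  "length zs = 4 \<Longrightarrow> \<exists>a b c d. zs = [a,b,c,d]"
  "length zs = 5 \<Longrightarrow> \<exists>a b c d e. zs = [a,b,c,d,e]"
  "length zs = 6 \<Longrightarrow> \<exists>a b c d e f. zs = [a,b,c,d,e,f]"
  by (simp_all add: eval_nat_numeral length_Suc_conv) blast+

lemma ex_distinct2:
  assumes "2 \<le> card S" obtains a b where "a \<in> S" "b \<in> S" "a \<noteq> b"
proof -
  obtain zs where "length zs = 2" "distinct zs" "set zs \<subseteq> S" using ex_distinct_list[OF assms] by blast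
  then show thesis using that by (auto simp: numeral_2_eq_2 length_Suc_conv)
qed

lemma ex_distinct3:
  assumes "3 \<le> card S" obtains a b c where "a \<in> S" "b \<in> S" "c \<in> S" "distinct [a,b,c]"
proof -
  obtain zs where "length zs = 3" "distinct zs" "set zs \<subseteq> S" using ex_distinct_list[OF assms] by blast
  then show thesis using that by (auto simp: numeral_3_eq_3 length_Suc_conv)
qed

text \<open>In the application \<open>C\<close> is the common neighbourhood of two adjacent vertices \<open>v\<close> and \<open>p\<close>, and
  \<open>X1\<close> and \<open>X2\<close> consist of further neighbours of \<open>v\<close> and of \<open>p\<close>, respectively. A path as in
  \<open>no_seven\<close> together with \<open>p\<close> (or \<open>v\<close>) is the rim of a wheel with hub \<open>v\<close> (or \<open>p\<close>).\<close>

locale seven_free =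
  fixes E :: "'a \<Rightarrow> 'a \<Rightarrow> bool" and C X1 X2 :: "'a set" and D :: nat
  assumes sym: "E x y \<Longrightarrow> E y x"
    and irr: "\<not> E x x"
    and finC: "finite C" and finX: "finite X1" "finite X2"
    and disj: "C \<inter> X1 = {}" "C \<inter> X2 = {}" "X1 \<inter> X2 = {}"
    and cardX: "card X1 = D" "card X2 = D"
    and D3: "3 \<le> D" and C6: "6 \<le> card C" and D4: "card C = 6 \<Longrightarrow> 4 \<le> D"
    and deg: "c \<in> C \<Longrightarrow> D + 4 \<le> card {x \<in> X1 \<union> X2. E c x} + card {x \<in> C. E c x}"
    and no_seven: "length zs = 7 \<Longrightarrow> distinct zs \<Longrightarrow> successively E zs \<Longrightarrow> hd zs \<in> C \<Longrightarrow>
      last zs \<in> C \<Longrightarrow> set zs \<subseteq> C \<union> X1 \<or> set zs \<subseteq> C \<union> X2 \<Longrightarrow> False"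
begin

section \<open>Neighbours inside and outside the common neighbourhood\<close>

abbreviation X :: "'a set" where "X \<equiv> X1 \<union> X2"

definition w :: "'a \<Rightarrow> nat" where "w c = card {x \<in> C. E c x}"

definition nd :: "'a \<Rightarrow> 'a set" where "nd c = {x \<in> X. E c x}"

definition pth :: "'a list \<Rightarrow> bool" where
  "pth zs \<longleftrightarrow> distinct zs \<and> set zs \<subseteq> C \<and> successively E zs"

lemma finnd [simp]: "finite (nd c)"
  using finX by (auto simp: nd_def)

lemma cardX12: "card X = 2 * D"
  using cardX finX disj by (simp add: card_Un_disjoint)

lemma nd_sub: "nd c \<subseteq> X"
  by (auto simp: nd_def)

lemma deg': "c \<in> C \<Longrightarrow> D + 4 \<le> card (nd c) + w c"
  using deg by (simp add: nd_def w_def)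

text \<open>Outside \<open>C\<close> the two vertices have at least
  \<open>2 * (D + 4) - w a - w b\<close> neighbours in all, counted with multiplicity, and
  \<open>X\<close> has only \<open>2 * D\<close> elements.\<close>

lemma common2: assumes "a \<in> C" "b \<in> C" shows "8 \<le> card (nd a \<inter> nd b) + w a + w b"
proof -
  have "card (nd a \<union> nd b) \<le> 2 * D"
    using card_mono[of X "nd a \<union> nd b"] finX nd_sub cardX12 by auto
  moreover have "card (nd a) + card (nd b) = card (nd a \<union> nd b) + card (nd a \<inter> nd b)"
    by (intro card_Un_Int) auto
  ultimately show ?thesis using deg'[OF assms(1)] deg'[OF assms(2)] by linarith
qed

text \<open>The three disjoint sets have to fit into \<open>X\<close>. Upper bounds on
  \<open>w\<close> at the ends of longest paths will contradict this.\<close>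

lemma disjoint_nd3:
  assumes "a \<in> C" "b \<in> C" "c \<in> C" "nd a \<inter> nd b = {}" "nd a \<inter> nd c = {}" "nd b \<inter> nd c = {}"
  shows "D + 12 \<le> w a + w b + w c"
proof -
  have "card (nd a \<union> nd b \<union> nd c) \<le> 2 * D"
    using card_mono[of X "nd a \<union> nd b \<union> nd c"] finX nd_sub cardX12 by auto
  moreover have "card (nd a \<union> nd b \<union> nd c) = card (nd a) + card (nd b) + card (nd c)"
    using assms by (subst card_Un_disjoint; (simp add: Int_Un_distrib2)?)+
  ultimately show ?thesis using deg'[OF assms(1)] deg'[OF assms(2)] deg'[OF assms(3)] by linarith
qed

section \<open>Paths in \<open>C\<close> and their extension through an outside vertex\<close>

definition longest :: "'a list \<Rightarrow> bool" where
  "longest xs \<longleftrightarrow> pth xs \<and> xs \<noteq> [] \<and> (\<forall>ys. pth ys \<longrightarrow> length ys \<le> length xs)"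

lemma pth_rev: "pth xs \<Longrightarrow> pth (rev xs)"
  unfolding pth_def successively_rev by (auto elim!: successively_mono intro: sym)

lemma pth_append: "pth xs \<Longrightarrow> pth ys \<Longrightarrow> set xs \<inter> set ys = {} \<Longrightarrow>
   (xs \<noteq> [] \<Longrightarrow> ys \<noteq> [] \<Longrightarrow> E (last xs) (hd ys)) \<Longrightarrow> pth (xs @ ys)"
  by (auto simp: pth_def successively_append_iff)

lemma pth_take: "pth xs \<Longrightarrow> pth (take i xs)"
  unfolding pth_def
  by (metis append_take_drop_id distinct_take successively_append_iff set_take_subset subset_trans)

lemma pth_drop: "pth xs \<Longrightarrow> pth (drop i xs)"
  unfolding pth_def
  by (metis append_take_drop_id distinct_drop successively_append_iff set_drop_subset subset_trans)

lemma pth_le6: assumes "pth xs" shows "length xs \<le> 6"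
proof (rule ccontr)
  assume "\<not> ?thesis"
  then have l: "length (take 7 xs) = 7" by auto
  have p: "pth (take 7 xs)" using assms by (rule pth_take)
  have ne: "take 7 xs \<noteq> []" using l by fastforce
  show False
    using no_seven[OF l] p ne unfolding pth_def
    by (metis hd_in_set last_in_set le_supI1 subsetD)
qed

text \<open>A common outside neighbour \<open>d\<close> would glue a final piece of
  \<open>xs\<close> to an initial piece of \<open>ys\<close>; trimmed to six vertices together, the
  pieces form with \<open>d\<close> a path excluded by \<open>no_seven\<close>. A single outside
  vertex lies in \<open>X1\<close> or \<open>X2\<close>, so the condition on sides is
  automatic.\<close>

lemma join_by_one:
  assumes "pth xs" "pth ys" "xs \<noteq> []" "ys \<noteq> []" "set xs \<inter> set ys = {}" "6 \<le> length xs + length ys"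
  shows "nd (last xs) \<inter> nd (hd ys) = {}"
proof (rule ccontr)
  assume "\<not> ?thesis"
  then obtain d where d: "d \<in> X" "E (last xs) d" "E (hd ys) d" by (auto simp: nd_def)
  \<comment> \<open>\<open>xs\<close> contributes its last \<open>i\<close> vertices and
    \<open>ys\<close> its first \<open>6 - i\<close>; the cap 5 leaves at least one vertex of
    \<open>ys\<close>.\<close>
  define i where "i = min 5 (length xs)"
  define xs' ys' where "xs' = drop (length xs - i) xs" and "ys' = take (6 - i) ys"
  have i: "1 \<le> i" "i \<le> 5" "i \<le> length xs" "6 - i \<le> length ys"
    using assms(3,4,6) by (cases "length xs \<le> 5"; cases xs; cases ys; simp add: i_def)+
  have p: "pth xs'" "pth ys'" using assms pth_take pth_drop by (auto simp: xs'_def ys'_def)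
  have len: "length xs' = i" "length ys' = 6 - i" using i by (auto simp: xs'_def ys'_def)
  then have ne: "xs' \<noteq> []" "ys' \<noteq> []" using i by auto
  have lh: "last xs' = last xs" "hd ys' = hd ys"
    using ne i by (auto simp: xs'_def ys'_def)
  have dis: "set xs' \<inter> set ys' = {}"
    using assms(5) set_drop_subset[of _ xs] set_take_subset[of _ ys]
    by (fastforce simp: xs'_def ys'_def)
  have dC: "d \<notin> C" using d disj by auto
  have suc: "successively E (xs' @ d # ys')"
    using p ne lh d by (cases ys') (auto simp: successively_append_iff pth_def successively_Cons intro: sym)
  have "length (xs' @ d # ys') = 7" using len i by simp
  moreover have "distinct (xs' @ d # ys')" using p dis dC by (auto simp: pth_def)
  moreover note suc
  moreover have "hd (xs' @ d # ys') \<in> C" "last (xs' @ d # ys') \<in> C"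
    using p ne by (auto simp: pth_def)
  moreover have "set (xs' @ d # ys') \<subseteq> C \<union> X1 \<or> set (xs' @ d # ys') \<subseteq> C \<union> X2"
    using p d by (auto simp: pth_def)
  ultimately show False by (rule no_seven)
qed

text \<open>A greatest length exists because of \<open>pth_le6\<close>. The set \<open>A\<close>
  will be all of \<open>C\<close>, and later what a longest path of \<open>C\<close> leaves
  over.\<close>

lemma longest_path:
  assumes "A \<subseteq> C" "A \<noteq> {}"
  obtains xs where "pth xs" "set xs \<subseteq> A" "xs \<noteq> []"
    "\<And>ys. pth ys \<Longrightarrow> set ys \<subseteq> A \<Longrightarrow> length ys \<le> length xs"
proof -
  let ?P = "\<lambda>n. \<exists>xs. pth xs \<and> set xs \<subseteq> A \<and> xs \<noteq> [] \<and> length xs = n"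
  obtain a where a: "a \<in> A" using assms by auto
  have 1: "?P 1" using a assms by (intro exI[of _ "[a]"]) (auto simp: pth_def)
  have b: "?P n \<Longrightarrow> n \<le> 6" for n using pth_le6 by blast
  define m where "m = (GREATEST n. ?P n)"
  have "?P m" unfolding m_def by (rule GreatestI_nat[of ?P, OF 1]) (use b in blast)
  then obtain xs where xs: "pth xs" "set xs \<subseteq> A" "xs \<noteq> []" "length xs = m" by blast
  have "length ys \<le> m" if "pth ys" "set ys \<subseteq> A" for ys
  proof (cases "ys = []")
    case False
    then have "?P (length ys)" using that by blast
    then show ?thesis unfolding m_def by (rule Greatest_le_nat[of ?P]) (use b in blast)
  qed simp
  then show thesis using that xs by blast
qed

text \<open>A neighbour in \<open>C\<close> off the path could be put in front of it.\<close>

lemma w_end: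
  assumes "longest xs"
  shows "{x \<in> C. E (hd xs) x} \<subseteq> set (tl xs)" "w (hd xs) \<le> length xs - 1"
proof -
  have xs: "pth xs" "xs \<noteq> []" using assms by (auto simp: longest_def)
  have "x \<in> set (tl xs)" if x: "x \<in> C" "E (hd xs) x" for x
  proof (rule ccontr)
    assume n: "x \<notin> set (tl xs)"
    have "x \<noteq> hd xs" using x irr by auto
    then have "x \<notin> set xs" using n xs(2) by (cases xs) auto
    then have "pth (x # xs)" using x xs sym[of "hd xs" x] by (auto simp: pth_def successively_Cons)
    then show False using assms by (auto simp: longest_def)
  qed
  then show *: "{x \<in> C. E (hd xs) x} \<subseteq> set (tl xs)" by auto
  have "w (hd xs) \<le> card (set (tl xs))" unfolding w_def using * by (intro card_mono) auto
  also have "\<dots> \<le> length xs - 1" using card_length[of "tl xs"] by simp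
  finally show "w (hd xs) \<le> length xs - 1" .
qed

text \<open>A path \<open>ys\<close> disjoint from the longest path \<open>xs\<close>: the neighbours of its end on \<open>xs\<close> must be
  far from both ends of \<open>xs\<close>.\<close>

lemma w_second:
  assumes l: "longest xs"
    and ys: "pth ys" "ys \<noteq> []" "set xs \<inter> set ys = {}"
    and mx: "{x \<in> C. E (hd ys) x} \<subseteq> set xs \<union> set ys"
  shows "w (hd ys) \<le> (length ys - 1) + (length xs - 2 * length ys)"
proof -
  have xs: "pth xs" "xs \<noteq> []" using l by (auto simp: longest_def)
  have xs3: "length zs \<le> length xs" if "pth zs" for zs using l that by (auto simp: longest_def)
  let ?l = "length xs" and ?m = "length ys"
  have nb: "{x \<in> C. E (hd ys) x} \<subseteq> set (tl ys) \<union> (\<lambda>i. xs ! i) ` {?m ..< ?l - ?m}"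
  proof
    fix x assume "x \<in> {x \<in> C. E (hd ys) x}"
    then have x: "x \<in> C" "E (hd ys) x" by auto
    show "x \<in> set (tl ys) \<union> (\<lambda>i. xs ! i) ` {?m ..< ?l - ?m}"
    proof (cases "x \<in> set xs")
      case False
      then have "x \<in> set ys" using mx x by auto
      moreover have "x \<noteq> hd ys" using x irr by auto
      ultimately show ?thesis using ys by (cases ys) auto
    next
      case True
      then obtain i where i: "i < ?l" "xs ! i = x" by (auto simp: in_set_conv_nth)
      have l: "last (rev ys) = hd ys" using ys by (simp add: last_rev)
      \<comment> \<open>From \<open>ys\<close> one can enter \<open>xs\<close> at position
        \<open>i\<close> and run to either end. That neither path is longer than \<open>xs\<close>
        bounds \<open>i\<close> from below and from above.\<close>
      have "pth (rev ys @ drop i xs)"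
        using ys i x l xs set_drop_subset[of i xs]
        by (intro pth_append pth_rev pth_drop) (auto simp: hd_drop_conv_nth)
      from xs3[OF this] have 1: "?m \<le> i" using i by simp
      have "hd (rev (take (Suc i) xs)) = x" using i by (simp add: hd_rev take_Suc_conv_app_nth)
      then have "pth (rev ys @ rev (take (Suc i) xs))"
        using ys i x l xs set_take_subset[of "Suc i" xs]
        by (intro pth_append pth_rev pth_take) auto
      from xs3[OF this] have 2: "i < ?l - ?m" using i by simp
      show ?thesis using 1 2 i by auto
    qed
  qed
  have "w (hd ys) \<le> card (set (tl ys) \<union> (\<lambda>i. xs ! i) ` {?m ..< ?l - ?m})"
    unfolding w_def by (intro card_mono[OF _ nb]) auto
  also have "\<dots> \<le> card (set (tl ys)) + card ((\<lambda>i. xs ! i) ` {?m ..< ?l - ?m})"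
    by (rule card_Un_le)
  also have "\<dots> \<le> (?m - 1) + (?l - 2 * ?m)"
    using card_length[of "tl ys"] card_image_le[of "{?m ..< ?l - ?m}" "\<lambda>i. xs ! i"] by simp
  finally show ?thesis .
qed

text \<open>The path is \<open>a, x, b, y, c, z, d\<close> with \<open>x\<close>, \<open>y\<close>,
  \<open>z\<close> on the same side. They are chosen in turn, and the last one has to avoid two
  others, hence the number three.\<close>

lemma zigzag4:
  assumes c: "distinct [a,b,c,d]" "{a,b,c,d} \<subseteq> C" and Y: "Y = X1 \<or> Y = X2"
    and "3 \<le> card (nd a \<inter> nd b \<inter> Y)" "3 \<le> card (nd b \<inter> nd c \<inter> Y)" "3 \<le> card (nd c \<inter> nd d \<inter> Y)"
  shows False
proof -
  have pick: "\<exists>y \<in> S. y \<notin> T" if "card T < card S" "finite T" for S T :: "'a set"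
    using that card_mono by (metis linorder_not_le subsetI)
  obtain x where x: "x \<in> nd a \<inter> nd b \<inter> Y" using pick[of "{}" "nd a \<inter> nd b \<inter> Y"] assms by auto
  obtain y where y: "y \<in> nd b \<inter> nd c \<inter> Y" "y \<noteq> x" using pick[of "{x}" "nd b \<inter> nd c \<inter> Y"] assms by auto
  have "card {x, y} \<le> 2" by (simp add: card_insert_if)
  then obtain z where z: "z \<in> nd c \<inter> nd d \<inter> Y" "z \<noteq> x" "z \<noteq> y"
    using pick[of "{x,y}" "nd c \<inter> nd d \<inter> Y"] assms by auto
  have E: "E a x" "E x b" "E b y" "E y c" "E c z" "E z d"
    using x y z by (simp_all add: nd_def sym)
  have xyz: "x \<in> Y" "y \<in> Y" "z \<in> Y" "x \<notin> C" "y \<notin> C" "z \<notin> C" using x y z Y disj by blast+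
  have "distinct [a,x,b,y,c,z,d]" using xyz c y(2) z(2,3) by auto
  moreover have "set [a,x,b,y,c,z,d] \<subseteq> C \<union> X1 \<or> set [a,x,b,y,c,z,d] \<subseteq> C \<union> X2"
    using Y xyz c(2) by auto
  ultimately show False
    using no_seven[of "[a,x,b,y,c,z,d]"] c(2) E by simp
qed

lemma big_side: "5 \<le> card (nd a \<inter> nd b) \<Longrightarrow>
   3 \<le> card (nd a \<inter> nd b \<inter> X1) \<or> 3 \<le> card (nd a \<inter> nd b \<inter> X2)"
proof -
  assume h: "5 \<le> card (nd a \<inter> nd b)"
  have "nd a \<inter> nd b = (nd a \<inter> nd b \<inter> X1) \<union> (nd a \<inter> nd b \<inter> X2)" using nd_sub by auto
  then have "card (nd a \<inter> nd b) \<le> card (nd a \<inter> nd b \<inter> X1) + card (nd a \<inter> nd b \<inter> X2)"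
    by (metis card_Un_le)
  then show ?thesis using h by linarith
qed

text \<open>Colour a pair by a side on which it has three common neighbours; this two-colouring
  contains a monochromatic path on four vertices.\<close>

lemma five_sparse:
  assumes dist: "distinct [x,y,a,b,c]" "{x,y,a,b,c} \<subseteq> C"
    and ws: "w x \<le> 2" "w y \<le> 2" "w a \<le> 1" "w b \<le> 1" "w c \<le> 1"
  shows False
proof -
  define K where "K p q Y \<longleftrightarrow> 3 \<le> card (nd p \<inter> nd q \<inter> Y)" for p q Y
  have Ksym: "K p q Y \<longleftrightarrow> K q p Y" for p q Y by (simp add: K_def Int_commute)
  have K: "K p q X1 \<or> K p q X2" if "p \<in> C" "q \<in> C" "w p + w q \<le> 3" for p q
  proof -
    have "5 \<le> card (nd p \<inter> nd q)" using common2[OF that(1,2)] that(3) by linarith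
    then show ?thesis using big_side unfolding K_def by blast
  qed
  have four: False if "distinct [p,q,r,s]" "{p,q,r,s} \<subseteq> C" "Y = X1 \<or> Y = X2" "K p q Y" "K q r Y" "K r s Y"
    for p q r s Y
    using zigzag4 that unfolding K_def by blast
  \<comment> \<open>Let \<open>p, q, r\<close> be a path of colour \<open>Y\<close>. By
    \<open>four\<close> it cannot be extended in this colour, so the pairs \<open>x p\<close>,
    \<open>r x\<close> and \<open>r y\<close> have colour \<open>Z\<close>, and
    \<open>p, x, r, y\<close> is a path of that colour.\<close>
  have star: False if d: "distinct [x,y,p,q,r]" "{x,y,p,q,r} \<subseteq> C" "w p \<le> 1" "w r \<le> 1"
    and Y: "Y = X1 \<and> Z = X2 \<or> Y = X2 \<and> Z = X1" and k: "K p q Y" "K q r Y" for p q r Y Z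
  proof -
    have m: "Y = X1 \<or> Y = X2" "Z = X1 \<or> Z = X2" using Y by blast+
    have "\<not> K x p Y" using four[of x p q r Y, OF _ _ m(1) _ k] d by auto
    moreover have "\<not> K r x Y" using four[of p q r x Y, OF _ _ m(1) k] d by auto
    moreover have "\<not> K r y Y" using four[of p q r y Y, OF _ _ m(1) k] d by auto
    moreover have "K x p X1 \<or> K x p X2" "K r x X1 \<or> K r x X2" "K r y X1 \<or> K r y X2"
      using K d(1,2,3,4) ws by auto
    ultimately have kz: "K x p Z" "K r x Z" "K r y Z" using Y by blast+
    show False
      using four[of p x r y Z, OF _ _ m(2)] d kz Ksym[of p x] Ksym[of x r] by auto
  qed
  have "K a b X1 \<or> K a b X2" "K b c X1 \<or> K b c X2" "K a c X1 \<or> K a c X2"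
    using K dist ws by auto
  \<comment> \<open>Two of the three pairs among \<open>a\<close>, \<open>b\<close>,
    \<open>c\<close> have the same colour, and any two of these pairs share a vertex, which becomes
    \<open>q\<close>.\<close>
  then consider "K a b X1" "K b c X1" | "K a b X2" "K b c X2" | "K b c X1" "K c a X1"
    | "K b c X2" "K c a X2" | "K b a X1" "K a c X1" | "K b a X2" "K a c X2"
    using Ksym[of a b] Ksym[of b c] Ksym[of a c] by blast
  then obtain p q r Y Z where Y: "Y = X1 \<and> Z = X2 \<or> Y = X2 \<and> Z = X1" "K p q Y" "K q r Y"
    and pqr: "(p, q, r) = (a, b, c) \<or> (p, q, r) = (b, c, a) \<or> (p, q, r) = (b, a, c)"
    by cases blast+
  have "distinct [x,y,p,q,r]" "{x,y,p,q,r} \<subseteq> C" "w p \<le> 1" "w r \<le> 1"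
    using pqr dist ws by auto
  from star[OF this Y] show False .
qed

text \<open>Cases on the sizes \<open>?l\<close> and \<open>?m\<close> of a longest path
  \<open>xs\<close> in \<open>C\<close> and a longest path \<open>ys\<close> in the rest. If
  \<open>6 \<le> ?l + ?m\<close>, ends of the two paths have no common outside neighbour, so by
  \<open>common2\<close> their values of \<open>w\<close> are large, against the bounds from
  maximality. Otherwise all relevant values of \<open>w\<close> are small, and the many common
  outside neighbours yield an alternating path.\<close>

lemma contradiction: False
proof -
  have "C \<noteq> {}" using C6 by auto
  then obtain xs where xs: "pth xs" "xs \<noteq> []"
    and mxl: "\<And>ys. pth ys \<Longrightarrow> set ys \<subseteq> C \<Longrightarrow> length ys \<le> length xs"
    using longest_path[OF subset_refl] by metis
  have xs3: "length zs \<le> length xs" if "pth zs" for zs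
    using mxl[OF that] that by (simp add: pth_def)
  have l: "longest xs" unfolding longest_def using xs xs3 by blast
  let ?l = "length xs"
  have setxs: "set xs \<subseteq> C" and lenxs: "card (set xs) = ?l"
    using xs(1) by (auto simp: pth_def distinct_card)
  have l6: "?l \<le> 6" using pth_le6 xs(1) .
  have lr: "longest (rev xs)" using l pth_rev[OF xs(1)] by (simp add: longest_def)
  then have rxs: "pth (rev xs)" "rev xs \<noteq> []" by (simp_all add: longest_def)
  have wh: "w (hd xs) \<le> ?l - 1" using w_end(2)[OF l] .
  have wl: "w (last xs) \<le> ?l - 1" using w_end(2)[OF lr] xs(2) by (simp add: hd_rev)
  have hC: "hd xs \<in> C" "last xs \<in> C" using xs(2) setxs by auto
  \<comment> \<open>Cutting the path in the middle and reversing both halves brings its two ends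
    next to each other.\<close>
  have six: "nd (hd xs) \<inter> nd (last xs) = {}" if "?l = 6"
  proof -
    have "nd (last (rev (take 3 xs))) \<inter> nd (hd (rev (drop 3 xs))) = {}"
      using xs(1,2) that set_take_disj_set_drop_if_distinct[of xs 3 3]
      by (intro join_by_one pth_rev pth_take pth_drop) (auto simp: pth_def)
    then show ?thesis using xs(2) that by (simp add: last_rev hd_rev)
  qed
  show False
  proof (cases "set xs = C")
    case True
    then have l6': "?l = 6" using l6 C6 lenxs by simp
    then have D4: "4 \<le> D" using D4 True lenxs by simp
    obtain q1 q2 q3 q4 q5 q6 where q: "xs = [q1,q2,q3,q4,q5,q6]"
      using list_of_length(4)[OF l6'] by blast
    have w5: "w c \<le> 5" if "c \<in> C" for c
    proof -
      have "w c \<le> card (C - {c})" unfolding w_def using finC irr by (intro card_mono) auto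
      also have "\<dots> = 5" using that True lenxs l6' finC by simp
      finally show ?thesis .
    qed
    \<comment> \<open>The outside neighbourhoods of \<open>q1\<close>, \<open>q2\<close> and
      \<open>q6\<close> turn out to be pairwise disjoint, so \<open>D + 12 \<le> 15\<close>, against
      \<open>4 \<le> D\<close>.\<close>
    have "nd q1 \<inter> nd q2 = {}"
      using join_by_one[of "[q1]" "[q2,q3,q4,q5,q6]"] xs(1) by (auto simp: q pth_def)
    moreover have "nd q2 \<inter> nd q6 = {}"
      using join_by_one[of "[q1,q2]" "rev [q3,q4,q5,q6]"] pth_rev[of "[q3,q4,q5,q6]"] xs(1)
      by (auto simp: q pth_def)
    moreover have "nd q1 \<inter> nd q6 = {}" using six l6' by (simp add: q)
    moreover have "q1 \<in> C" "q2 \<in> C" "q6 \<in> C" using setxs q by auto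
    ultimately show False using disjoint_nd3[of q1 q2 q6] w5[of q1] w5[of q2] w5[of q6] D4 by simp
  next
    case False
    define A where "A = C - set xs"
    have A: "A \<subseteq> C" "A \<noteq> {}" "finite A" using False setxs finC by (auto simp: A_def)
    obtain ys where ys: "pth ys" "set ys \<subseteq> A" "ys \<noteq> []"
      "\<And>zs. pth zs \<Longrightarrow> set zs \<subseteq> A \<Longrightarrow> length zs \<le> length ys"
      using longest_path[OF A(1,2)] by blast
    let ?m = "length ys"
    have m1: "1 \<le> ?m" using ys(3) by (cases ys) auto
    have ml: "?m \<le> ?l" using xs3[OF ys(1)] .
    have dsj: "set xs \<inter> set ys = {}" using ys(2) by (auto simp: A_def)
    have mx: "{z \<in> C. E (hd zs) z} \<subseteq> set xs \<union> set zs"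
      if zs: "pth zs" "set zs \<subseteq> A" "length zs = ?m" for zs
    proof (rule ccontr)
      assume "\<not> ?thesis"
      then obtain z where z: "z \<in> C" "z \<notin> set xs" "z \<notin> set zs" "E z (hd zs)" using sym by blast
      then have "pth (z # zs)" "set (z # zs) \<subseteq> A"
        using zs by (auto simp: pth_def successively_Cons A_def)
      from ys(4)[OF this] show False using zs by simp
    qed
    have wy: "w (hd ys) \<le> (?m - 1) + (?l - 2 * ?m)"
      using w_second[OF l ys(1,3) dsj mx[OF ys(1,2) refl]] .
    have rys: "pth (rev ys)" "set (rev ys) \<subseteq> A" "length (rev ys) = ?m" "rev ys \<noteq> []"
      "set xs \<inter> set (rev ys) = {}"
      using ys(2,3) pth_rev[OF ys(1)] dsj by simp_all
    have "w (hd (rev ys)) \<le> (length (rev ys) - 1) + (?l - 2 * length (rev ys))"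
      by (rule w_second[OF l rys(1,4,5) mx[OF rys(1-3)]])
    then have wy': "w (last ys) \<le> (?m - 1) + (?l - 2 * ?m)" using ys(3) by (simp add: hd_rev)
    have yC: "hd ys \<in> C" "last ys \<in> C" using ys(2,3) A(1) by (meson hd_in_set last_in_set subsetD)+
    have join: "nd (last xs) \<inter> nd (hd ys) = {}" "nd (hd xs) \<inter> nd (hd ys) = {}"
      "nd (last xs) \<inter> nd (last ys) = {}" "nd (hd xs) \<inter> nd (last ys) = {}" if "6 \<le> ?l + ?m"
      using join_by_one[OF xs(1) ys(1)] join_by_one[OF rxs(1) ys(1)]
        join_by_one[OF xs(1) rys(1)] join_by_one[OF rxs(1) rys(1)] xs(2) ys(3) dsj that
      by (simp_all add: hd_rev last_rev)
    have low: False if "6 \<le> ?l + ?m" "w (hd xs) + w (hd ys) \<le> 7"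
      using common2[OF hC(1) yC(1)] join(2)[OF that(1)] that(2) by simp
    consider "?l = 6" | "?l = 5" | "?l = 4" | "?l \<le> 3" using l6 by linarith
    then show False
    proof cases
      case 1
      \<comment> \<open>The ends of \<open>xs\<close> have \<open>w\<close> at most 5, so
        \<open>hd ys\<close> has \<open>w\<close> at least \<open>D + 2\<close>, which
        \<open>wy\<close> permits only for \<open>?m = 6\<close>. Then all four ends have pairwise
        disjoint outside neighbourhoods, and \<open>4 * (D + 4) - 20 \<le> 2 * D\<close> contradicts
        \<open>3 \<le> D\<close>.\<close>
      have "D + 12 \<le> w (hd xs) + w (last xs) + w (hd ys)"
        using disjoint_nd3[OF hC(1,2) yC(1)] six join 1 by auto
      then have "5 \<le> w (hd ys)" using wh wl 1 D3 by auto
      then have m6: "?m = 6" using wy ml 1 m1 by auto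
      have "nd (last (rev (take 3 ys))) \<inter> nd (hd (rev (drop 3 ys))) = {}"
        using ys(1,3) m6 set_take_disj_set_drop_if_distinct[of ys 3 3]
        by (intro join_by_one pth_rev pth_take pth_drop) (auto simp: pth_def)
      then have "nd (hd ys) \<inter> nd (last ys) = {}" using ys(3) m6 by (simp add: last_rev hd_rev)
      then have dd: "(nd (hd xs) \<union> nd (last xs)) \<inter> (nd (hd ys) \<union> nd (last ys)) = {}"
        "nd (hd ys) \<inter> nd (last ys) = {}" "nd (hd xs) \<inter> nd (last xs) = {}"
        using six join 1 by auto
      have "card (nd (hd xs) \<union> nd (last xs) \<union> (nd (hd ys) \<union> nd (last ys))) \<le> 2 * D"
        unfolding cardX12[symmetric] using finX nd_sub by (intro card_mono) auto
      then have "card (nd (hd xs)) + card (nd (last xs)) + (card (nd (hd ys)) + card (nd (last ys))) \<le> 2 * D"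
        using dd by (simp add: card_Un_disjoint)
      then show False
        using deg'[OF hC(1)] deg'[OF hC(2)] deg'[OF yC(1)] deg'[OF yC(2)] wh wl wy wy' 1 m6 D3 by simp
    next
      case 2
      show False
      proof (cases "?m = 5")
        case False
        then show False using low 2 wh wy m1 ml by linarith
      next
        case m5: True
        obtain q1 q2 q3 q4 q5 where q: "xs = [q1,q2,q3,q4,q5]"
          using list_of_length(3)[OF 2] by blast
        \<comment> \<open>\<open>S\<close> has at most \<open>D\<close> elements. Every path through
          the vertices of \<open>xs\<close> starts at a vertex whose outside neighbours lie in
          \<open>S\<close> and number at least \<open>D\<close>, so they are all of
          \<open>S\<close>.\<close>
        define S where "S = X - nd (hd ys)"
        have ndy: "D \<le> card (nd (hd ys))" using deg'[OF yC(1)] wy 2 m5 by simp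
        have cS: "card S = 2 * D - card (nd (hd ys))"
          unfolding S_def using nd_sub cardX12 by (simp add: card_Diff_subset)
        have ends: "nd (hd zs) = S \<and> 4 \<le> w (hd zs) \<and> D \<le> card S"
          if zs: "pth zs" "length zs = 5" "set zs = set xs" for zs
        proof -
          have ne: "zs \<noteq> []" using zs by auto
          have "longest zs" using zs(1,2) ne xs3 2 by (simp add: longest_def)
          then have wz: "w (hd zs) \<le> 4" using w_end(2) zs(2) by fastforce
          have zC: "hd zs \<in> C" using zs(1) ne by (auto simp: pth_def)
          have "nd (hd zs) \<inter> nd (hd ys) = {}"
            using join_by_one[OF pth_rev[OF zs(1)] ys(1)] ne ys(3) dsj zs(2,3) m5 by (simp add: last_rev)
          then have sub: "nd (hd zs) \<subseteq> S" using nd_sub by (auto simp: S_def)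
          have fS: "finite S" using finX by (simp add: S_def)
          have le: "card (nd (hd zs)) \<le> card S" using sub fS by (rule card_mono[rotated])
          have ge: "D + 4 \<le> card (nd (hd zs)) + w (hd zs)" using deg'[OF zC] .
          have "card (nd (hd zs)) = card S" using le ge wz cS ndy by linarith
          then show ?thesis using card_subset_eq[OF fS sub] ge wz cS ndy by auto
        qed
        have e1: "nd q1 = S" "4 \<le> w q1" "D \<le> card S" using ends[OF xs(1) 2 refl] by (auto simp: q)
        have "nd (hd (rev xs)) = S" using ends[OF rxs(1)] 2 by simp
        then have e5: "nd q5 = S" by (simp add: q)
        have "{x \<in> C. E q1 x} = {q2,q3,q4,q5}"
        proof (rule card_seteq)
          show "{x \<in> C. E q1 x} \<subseteq> {q2,q3,q4,q5}" using w_end(1)[OF l] by (simp add: q)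
          show "card {q2,q3,q4,q5} \<le> card {x \<in> C. E q1 x}"
            using e1(2) card_length[of "[q2,q3,q4,q5]"] by (simp add: w_def)
        qed simp
        \<comment> \<open>Since \<open>q1\<close> is adjacent to the whole path, the path can be
          rerouted to start at \<open>q2\<close>. So \<open>q1\<close>, \<open>q2\<close> and
          \<open>q5\<close> all have the outside neighbourhood \<open>S\<close>, and two elements of
          \<open>S\<close> on one side complete a path on seven vertices.\<close>
        then have "E q1 q3" by blast
        then have p2: "pth [q2,q1,q3,q4,q5]" using xs(1) sym[of q1 q2] by (auto simp: q pth_def)
        have "nd (hd [q2,q1,q3,q4,q5]) = S" using ends[OF p2] by (simp add: q insert_commute)
        then have e2: "nd q2 = S" by simp
        have S12: "S = (S \<inter> X1) \<union> (S \<inter> X2)" by (auto simp: S_def)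
        have "card S \<le> card (S \<inter> X1) + card (S \<inter> X2)" by (metis S12 card_Un_le)
        then have "2 \<le> card (S \<inter> X1) \<or> 2 \<le> card (S \<inter> X2)" using e1(3) D3 by linarith
        then obtain Y where Y: "Y = X1 \<or> Y = X2" "2 \<le> card (S \<inter> Y)" by blast
        obtain d d' where d: "d \<in> S" "d' \<in> S" "d \<in> Y" "d' \<in> Y" "d \<noteq> d'"
          using ex_distinct2[OF Y(2)] by blast
        have dC: "d \<notin> C" "d' \<notin> C" using d Y disj by blast+
        have Ed: "E q1 d" "E d q2" "E q2 d'" "E d' q5"
          using d(1,2) e1(1) e2 e5 sym by (auto simp: nd_def)
        have qC: "q1 \<in> C" "q2 \<in> C" "q3 \<in> C" "q4 \<in> C" "q5 \<in> C" "distinct [q1,q2,q3,q4,q5]"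
          "E q5 q4" "E q4 q3"
          using xs(1) sym[of q4 q5] sym[of q3 q4] by (auto simp: q pth_def)
        have "distinct [q1,d,q2,d',q5,q4,q3]" using qC dC d(5) by auto
        moreover have "set [q1,d,q2,d',q5,q4,q3] \<subseteq> C \<union> X1 \<or> set [q1,d,q2,d',q5,q4,q3] \<subseteq> C \<union> X2"
          using Y d qC by auto
        ultimately show False using no_seven[of "[q1,d,q2,d',q5,q4,q3]"] qC Ed by simp
      qed
    next
      case 3
      show False
      proof (cases "?m = 1")
        case False
        then have "?m = 2 \<or> ?m = 3 \<or> ?m = 4" using m1 ml 3 by linarith
        then show False using low 3 wh wy by auto
      next
        case m: True
        \<comment> \<open>Now \<open>A\<close> contains no edge, and a vertex of \<open>A\<close>
          can only be adjacent to the two inner vertices of \<open>xs\<close>.\<close>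
        have w2: "w o' \<le> 2" if "o' \<in> A" for o'
        proof -
          have "pth [o']" "set xs \<inter> set [o'] = {}" using that by (auto simp: A_def pth_def)
          moreover from this(1) have "{z \<in> C. E (hd [o']) z} \<subseteq> set xs \<union> set [o']"
            using that m by (intro mx) simp_all
          ultimately show ?thesis using w_second[OF l, of "[o']"] 3 by simp
        qed
        have "2 \<le> card A"
          using C6 lenxs 3 finC setxs by (simp add: A_def card_Diff_subset finite_subset)
        then obtain a b where ab: "a \<in> A" "b \<in> A" "a \<noteq> b"
          using ex_distinct2 by blast
        obtain q1 q2 q3 q4 where q: "xs = [q1,q2,q3,q4]"
          using list_of_length(2)[OF 3] by blast
        have abC: "a \<in> C" "b \<in> C" "a \<notin> set xs" "b \<notin> set xs" using ab by (auto simp: A_def)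
        have cab: "4 \<le> card (nd a \<inter> nd b)" using common2[OF abC(1,2)] w2[of a] w2[of b] ab by simp
        have w3: "w q1 \<le> 3" "w q4 \<le> 3" using wh wl 3 by (auto simp: q)
        have cq: "3 \<le> card (nd p \<inter> nd r)" if "p = q1 \<or> p = q4" "r = a \<or> r = b" for p r
          using common2[of p r] that w2[OF ab(1)] w2[OF ab(2)] w3 abC setxs by (auto simp: q)
        have split: "nd p \<inter> nd r = (nd p \<inter> nd r \<inter> X1) \<union> (nd p \<inter> nd r \<inter> X2)" for p r
          using nd_sub by auto
        have "card (nd a \<inter> nd b) \<le> card (nd a \<inter> nd b \<inter> X1) + card (nd a \<inter> nd b \<inter> X2)"
          by (subst split) (rule card_Un_le)
        then have "2 \<le> card (nd a \<inter> nd b \<inter> X1) \<or> 2 \<le> card (nd a \<inter> nd b \<inter> X2)" using cab by linarith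
        then obtain Y Z where Y: "Y = X1 \<and> Z = X2 \<or> Y = X2 \<and> Z = X1" "2 \<le> card (nd a \<inter> nd b \<inter> Y)"
          by blast
        \<comment> \<open>Otherwise three vertices of \<open>xs\<close> ending in \<open>p\<close>,
          followed by \<open>d, r, d', s\<close>, form a path on seven vertices with both outside
          vertices in \<open>Y\<close>. So all common outside neighbours of an end of
          \<open>xs\<close> and one of \<open>a\<close>, \<open>b\<close> lie in \<open>Z\<close>,
          where \<open>zigzag4\<close> applies.\<close>
        have nY: "nd p \<inter> nd r \<inter> Y = {}"
          if pr: "p = q1 \<and> zs = [q3,q2,q1] \<or> p = q4 \<and> zs = [q2,q3,q4]"
            "r = a \<and> s = b \<or> r = b \<and> s = a" for p r s zs
        proof (rule ccontr)
          assume "\<not> ?thesis"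
          then obtain d where d: "d \<in> nd p" "d \<in> nd r" "d \<in> Y" by blast
          have "2 \<le> card (nd r \<inter> nd s \<inter> Y)" using Y(2) pr(2) by (auto simp: Int_commute)
          then obtain x y where "x \<in> nd r \<inter> nd s \<inter> Y" "y \<in> nd r \<inter> nd s \<inter> Y" "x \<noteq> y"
            using ex_distinct2 by blast
          then obtain d' where d': "d' \<in> nd r" "d' \<in> nd s" "d' \<in> Y" "d' \<noteq> d" by blast
          have dC: "d \<notin> C" "d' \<notin> C" using d d' Y disj by blast+
          have Ed: "E p d" "E d r" "E r d'" "E d' s"
            using d d' sym unfolding nd_def by blast+
          have zs: "pth zs" "last zs = p" "length zs = 3" "set zs \<subseteq> set xs"
            using xs(1) pr(1) sym[of q1 q2] sym[of q2 q3] by (auto simp: q pth_def)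
          have rs: "r \<in> C" "s \<in> C" "r \<notin> set zs" "s \<notin> set zs" "r \<noteq> s" using pr(2) abC ab(3) zs(4) by auto
          have zne: "zs \<noteq> []" and zC: "set zs \<subseteq> C" using zs by (auto simp: pth_def)
          have "distinct (zs @ [d,r,d',s])" using zs(1) zC rs dC d'(4) by (auto simp: pth_def)
          moreover have "successively E (zs @ [d,r,d',s])"
            using zs(1,2) Ed by (simp add: pth_def successively_append_iff)
          moreover have "set (zs @ [d,r,d',s]) \<subseteq> C \<union> X1 \<or> set (zs @ [d,r,d',s]) \<subseteq> C \<union> X2"
            using Y d d' rs zC by auto
          moreover have "hd (zs @ [d,r,d',s]) \<in> C" using zne zC by auto
          ultimately show False using no_seven[of "zs @ [d,r,d',s]"] zs(3) rs by simp
        qed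
        have Z: "3 \<le> card (nd p \<inter> nd r \<inter> Z)" if "p = q1 \<or> p = q4" "r = a \<or> r = b" for p r
        proof -
          have "nd p \<inter> nd r \<inter> Y = {}" using nY[of p _ r] that by blast
          then have "nd p \<inter> nd r \<inter> Z = nd p \<inter> nd r" using split[of p r] Y(1) by blast
          then show ?thesis using cq[OF that] by simp
        qed
        have "distinct [q1,a,q4,b]" "{q1,a,q4,b} \<subseteq> C" "Z = X1 \<or> Z = X2"
          using abC ab(3) xs(1) Y(1) by (auto simp: q pth_def)
        then show False using zigzag4[of q1 a q4 b Z] Z[of q1 a] Z[of q4 a] Z[of q4 b]
          by (simp add: Int_commute)
      qed
    next
      case 4
      show False
      proof (cases "?l = 3")
        case l3: True
        show False
        proof (cases "?m = 3")
          case True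
          then show False using low l3 wh wy by auto
        next
          case False
          then have m2: "?m \<le> 2" using ml l3 by simp
          \<comment> \<open>A vertex of \<open>A\<close> with a neighbour in \<open>A\<close> starts
            a path on two vertices, which is then longest in \<open>A\<close>; any other is a path
            by itself. For \<open>?l = 3\<close> the bound of \<open>w_second\<close> is 1 in both
            cases.\<close>
          have w1: "w a \<le> 1" if a: "a \<in> A" for a
          proof (cases "\<exists>b \<in> A. E a b")
            case True
            then obtain b where b: "b \<in> A" "E a b" by blast
            have "a \<noteq> b" using b irr by auto
            then have p: "pth [a, b]" using a b A by (auto simp: pth_def)
            then have "?m = 2" using ys(4)[of "[a,b]"] a b m2 by simp
            then show ?thesis
              using w_second[OF l p] mx[OF p] a b l3 by (simp add: A_def)
          next
            case False
            have p: "pth [a]" using a A by (auto simp: pth_def)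
            show ?thesis using w_second[OF l p] False a l3 by (auto simp: A_def)
          qed
          have "3 \<le> card A"
            using C6 lenxs l3 finC setxs by (simp add: A_def card_Diff_subset finite_subset)
          then obtain a b c where abc: "a \<in> A" "b \<in> A" "c \<in> A" "distinct [a,b,c]"
            using ex_distinct3 by blast
          obtain q1 q2 q3 where q: "xs = [q1,q2,q3]"
            using list_of_length(1)[OF l3] by blast
          have "distinct [q1,q3,a,b,c]" "{q1,q3,a,b,c} \<subseteq> C"
            using abc xs(1) by (auto simp: q A_def pth_def)
          then show False
            using five_sparse[of q1 q3 a b c] wh wl w1 abc l3 by (simp add: q)
        qed
      next
        case False
        then have l2: "?l \<le> 2" using 4 by simp
        have w1: "w c \<le> 1" if c: "c \<in> C" for c
        proof (rule ccontr)
          assume "\<not> ?thesis"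
          then have "2 \<le> card {x \<in> C. E c x}" by (simp add: w_def)
          then obtain a b where "a \<in> {x \<in> C. E c x}" "b \<in> {x \<in> C. E c x}" "a \<noteq> b"
            by (rule ex_distinct2)
          then have ab: "a \<in> C" "E c a" "b \<in> C" "E c b" "a \<noteq> b" by auto
          have "c \<noteq> a" "c \<noteq> b" "E a c" using ab irr sym by blast+
          then have "pth [a,c,b]" using ab c by (auto simp: pth_def)
          from xs3[OF this] show False using l2 by simp
        qed
        have "5 \<le> card C" using C6 by simp
        then obtain zs where zs: "length zs = 5" "distinct zs" "set zs \<subseteq> C"
          using ex_distinct_list by blast
        obtain x y a b c where "zs = [x,y,a,b,c]"
          using list_of_length(3)[OF zs(1)] by blast
        then have "distinct [x,y,a,b,c]" "{x,y,a,b,c} \<subseteq> C" using zs by auto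
        moreover from this have "w x \<le> 1" "w y \<le> 1" "w a \<le> 1" "w b \<le> 1" "w c \<le> 1" using w1 by auto
        ultimately show False using five_sparse[of x y a b c] by simp
      qed
    qed
  qed
qed

end

section \<open>Graphs of large minimum degree\<close>

text \<open>For \<open>A\<close> the neighbourhood of a vertex \<open>h\<close>, such a cycle is the
  rim of a wheel with hub \<open>h\<close>.\<close>

definition has_c8 :: "('a \<Rightarrow> 'a \<Rightarrow> bool) \<Rightarrow> 'a set \<Rightarrow> bool" where
  "has_c8 E A \<longleftrightarrow> (\<exists>zs. length zs = 8 \<and> distinct zs \<and> set zs \<subseteq> A \<and>
     successively E zs \<and> E (last zs) (hd zs))"

lemma ex_in_diff: "card T < card S \<Longrightarrow> finite T \<Longrightarrow> \<exists>y \<in> S. y \<notin> T"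
  using card_mono by (metis linorder_not_le subsetI)

lemma card_Int_ge:
  assumes "finite S" "A \<subseteq> S" "B \<subseteq> S"
  shows "card A + card B \<le> card (A \<inter> B) + card S"
proof -
  have "card A + card B = card (A \<union> B) + card (A \<inter> B)"
    using assms by (intro card_Un_Int) (auto intro: finite_subset)
  moreover have "card (A \<union> B) \<le> card S" using assms by (intro card_mono) auto
  ultimately show ?thesis by simp
qed

text \<open>Inclusion-exclusion with the triple intersection left out.\<close>

lemma card_Un3_ge:
  assumes "finite S" "A \<subseteq> S" "B \<subseteq> S" "C \<subseteq> S"
  shows "card A + card B + card C \<le> card (A \<inter> B) + card (A \<inter> C) + card (B \<inter> C) + card S"
proof -
  have f: "finite A" "finite B" "finite C" using assms by (auto intro: finite_subset)
  have "card A + card B = card (A \<union> B) + card (A \<inter> B)" using f by (intro card_Un_Int)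
  moreover have "card (A \<union> B) + card C = card (A \<union> B \<union> C) + card ((A \<union> B) \<inter> C)"
    using f by (intro card_Un_Int) auto
  moreover have "card ((A \<union> B) \<inter> C) \<le> card (A \<inter> C) + card (B \<inter> C)"
    by (metis Int_Un_distrib2 card_Un_le)
  moreover have "card (A \<union> B \<union> C) \<le> card S" using assms by (intro card_mono) auto
  ultimately show ?thesis by linarith
qed

locale simple_graph =
  fixes V :: "'a set" and E :: "'a \<Rightarrow> 'a \<Rightarrow> bool"
  assumes finV: "finite V"
    and sym: "E x y \<Longrightarrow> E y x"
    and irr: "\<not> E x x"
    and inV: "E x y \<Longrightarrow> x \<in> V"
begin

definition N :: "'a \<Rightarrow> 'a set" where "N x = {y. E x y}"

lemma E_comm: "E x y \<longleftrightarrow> E y x"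
  using sym by blast

lemma in_N [simp]: "y \<in> N x \<longleftrightarrow> E x y"
  by (simp add: N_def)

lemma inV2: "E x y \<Longrightarrow> y \<in> V"
  using inV[OF sym] .

lemma N_V: "N x \<subseteq> V"
  using inV2 by auto

lemma finN [simp]: "finite (N x)"
  using finite_subset[OF N_V finV] .

text \<open>The connecting vertices are chosen greedily. The one between \<open>a\<close> and
  \<open>b\<close> comes last and has to avoid three others, so only this pair needs four common
  neighbours.\<close>

lemma zigzag_c8:
  assumes q: "distinct [a,b,c,d]" "{a,b,c,d} \<subseteq> A" "{a,b,c,d} \<inter> S = {}" "S \<subseteq> A"
    and "4 \<le> card (N a \<inter> N b \<inter> S)" "3 \<le> card (N b \<inter> N c \<inter> S)" "3 \<le> card (N c \<inter> N d \<inter> S)"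
      "3 \<le> card (N d \<inter> N a \<inter> S)"
  shows "has_c8 E A"
proof -
  obtain y1 where y1: "y1 \<in> N b \<inter> N c \<inter> S"
    using ex_in_diff[of "{}" "N b \<inter> N c \<inter> S"] assms by auto
  obtain y2 where y2: "y2 \<in> N c \<inter> N d \<inter> S" "y2 \<noteq> y1"
    using ex_in_diff[of "{y1}" "N c \<inter> N d \<inter> S"] assms by auto
  have "card {y1, y2} \<le> 2" by (simp add: card_insert_if)
  then obtain y3 where y3: "y3 \<in> N d \<inter> N a \<inter> S" "y3 \<noteq> y1" "y3 \<noteq> y2"
    using ex_in_diff[of "{y1,y2}" "N d \<inter> N a \<inter> S"] assms by auto
  have "card {y1, y2, y3} \<le> 3" by (simp add: card_insert_if)
  then obtain y4 where y4: "y4 \<in> N a \<inter> N b \<inter> S" "y4 \<noteq> y1" "y4 \<noteq> y2" "y4 \<noteq> y3"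
    using ex_in_diff[of "{y1,y2,y3}" "N a \<inter> N b \<inter> S"] assms by auto
  have "y1 \<in> S" "y2 \<in> S" "y3 \<in> S" "y4 \<in> S" using y1 y2 y3 y4 by auto
  then have "distinct [a,y4,b,y1,c,y2,d,y3]" "set [a,y4,b,y1,c,y2,d,y3] \<subseteq> A"
    using q y2(2) y3(2,3) y4(2,3,4) by auto
  then show ?thesis unfolding has_c8_def using y1 y2 y3 y4
    by (intro exI[of _ "[a,y4,b,y1,c,y2,d,y3]"]) (simp add: E_comm)
qed

lemma double_count:
  assumes "finite A" "finite B"
  shows "(\<Sum>a\<in>A. card (N a \<inter> B)) = (\<Sum>b\<in>B. card (N b \<inter> A))"
proof -
  have "(\<Sum>a\<in>A. card (N a \<inter> B)) = (\<Sum>a\<in>A. \<Sum>b\<in>B. if E a b then 1 else 0)"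
    using assms by (intro sum.cong refl) (simp add: sum.If_cases Int_commute N_def)
  also have "\<dots> = (\<Sum>b\<in>B. \<Sum>a\<in>A. if E b a then 1 else 0)"
    by (subst sum.swap) (simp add: E_comm)
  also have "\<dots> = (\<Sum>b\<in>B. card (N b \<inter> A))"
    using assms by (intro sum.cong refl) (simp add: sum.If_cases Int_commute N_def)
  finally show ?thesis .
qed

end

section \<open>Codegrees under the minimum degree condition\<close>

locale wheel_free = simple_graph +
  fixes k :: nat
  assumes cardV: "card V = 2 * k + 1" and k8: "8 \<le> k"
    and mindeg: "x \<in> V \<Longrightarrow> k + 3 \<le> card (N x)"
    and no_wheel: "\<not> has_c8 E (N h)"
begin

definition cd :: "'a \<Rightarrow> 'a \<Rightarrow> nat" where "cd x y = card (N x \<inter> N y)"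

lemma cd_comm: "cd x y = cd y x"
  by (simp add: cd_def Int_commute)

text \<open>An instance of \<open>seven_free\<close> with \<open>D = k + 2 - card C\<close>. Only
  \<open>card C - 3\<close> vertices lie outside \<open>C\<close>, \<open>X1\<close> and
  \<open>X2\<close>, so a vertex of \<open>C\<close> has at least
  \<open>k + 3 - (card C - 3) = D + 4\<close> neighbours in these sets. The bound
  \<open>cd v p < k\<close> gives \<open>3 \<le> D\<close>.\<close>

lemma codegree_medium:
  assumes vp: "E v p" and h: "6 \<le> cd v p" "cd v p < k"
  shows False
proof -
  define C where "C = N v \<inter> N p"
  define D where "D = k + 2 - card C"
  have cC: "6 \<le> card C" "card C < k" using h by (auto simp: C_def cd_def)
  have finC: "finite C" by (simp add: C_def)
  have V: "v \<in> V" "p \<in> V" using vp inV sym by blast+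
  have side: "\<exists>X \<subseteq> N a - N b - {b}. card X = D" if "a = v \<and> b = p \<or> a = p \<and> b = v" for a b
  proof -
    have b: "b \<in> N a" "b \<notin> C" using that vp irr by (auto simp: C_def E_comm)
    have C': "C \<subseteq> N a" using that by (auto simp: C_def)
    have "N a - N b - {b} = N a - insert b C" using that by (auto simp: C_def)
    then have "card (N a - N b - {b}) = card (N a) - Suc (card C)"
      using b C' finC by (simp add: card_Diff_subset)
    moreover have "k + 3 \<le> card (N a)" using mindeg V that by auto
    ultimately have "D \<le> card (N a - N b - {b})" by (simp add: D_def)
    then show ?thesis by (meson obtain_subset_with_card_n)
  qed
  obtain X1 where X1: "X1 \<subseteq> N v - N p - {p}" "card X1 = D" using side[of v p] by auto
  obtain X2 where X2: "X2 \<subseteq> N p - N v - {v}" "card X2 = D" using side[of p v] by auto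
  have finX: "finite X1" "finite X2" using X1 X2 by (auto intro: finite_subset)
  have dsj: "C \<inter> X1 = {}" "C \<inter> X2 = {}" "X1 \<inter> X2 = {}" using X1 X2 by (auto simp: C_def)
  \<comment> \<open>A path on seven vertices in \<open>N a\<close> with both ends adjacent to
    \<open>b\<close> closes up through \<open>b\<close> to the rim of a wheel with hub
    \<open>a\<close>.\<close>
  have seven: False
    if zs: "length zs = 7" "distinct zs" "successively E zs" "hd zs \<in> C" "last zs \<in> C"
      "set zs \<subseteq> N a" "E a b" "b \<notin> set zs" "C \<subseteq> N b" for zs a b
  proof -
    have "zs \<noteq> []" using zs(1) by auto
    then have "length (b # zs) = 8 \<and> distinct (b # zs) \<and> set (b # zs) \<subseteq> N a \<and>
       successively E (b # zs) \<and> E (last (b # zs)) (hd (b # zs))"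
      using zs sym[of b "last zs"] by (auto simp: successively_Cons)
    then have "has_c8 E (N a)" unfolding has_c8_def by blast
    then show False using no_wheel by blast
  qed
  interpret seven_free E C X1 X2 D
  proof
    show "D + 4 \<le> card {x \<in> X1 \<union> X2. E c x} + card {x \<in> C. E c x}" if "c \<in> C" for c
    proof -
      let ?R = "V - (C \<union> (X1 \<union> X2))"
      have sub: "C \<union> (X1 \<union> X2) \<subseteq> V" using X1 X2 N_V unfolding C_def by blast
      have cX: "card (C \<union> (X1 \<union> X2)) = card C + 2 * D"
        using dsj finX finC X1(2) X2(2) by (simp add: card_Un_disjoint Int_Un_distrib)
      have "card ?R = card V - (card C + 2 * D)"
        using sub cX finC finX by (simp add: card_Diff_subset)
      moreover have "card C + 2 * D \<le> card V" using sub cX finV card_mono by metis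
      moreover have "k + 3 \<le> card (N c)" using mindeg[of c] that inV2 by (auto simp: C_def)
      moreover have "card (N c) \<le> card {x \<in> X1 \<union> X2. E c x} + card {x \<in> C. E c x} + card ?R"
      proof -
        have "N c \<subseteq> {x \<in> X1 \<union> X2. E c x} \<union> {x \<in> C. E c x} \<union> ?R" using N_V by auto
        then have "card (N c) \<le> card ({x \<in> X1 \<union> X2. E c x} \<union> {x \<in> C. E c x} \<union> ?R)"
          using finX finC finV by (intro card_mono) auto
        also have "\<dots> \<le> card {x \<in> X1 \<union> X2. E c x} + card {x \<in> C. E c x} + card ?R"
          by (meson add_le_mono1 card_Un_le order_trans)
        finally show ?thesis .
      qed
      ultimately show ?thesis using cC cardV unfolding D_def by linarith
    qed
    fix zs assume zs: "length zs = 7" "distinct zs" "successively E zs" "hd zs \<in> C" "last zs \<in> C"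
      and z: "set zs \<subseteq> C \<union> X1 \<or> set zs \<subseteq> C \<union> X2"
    have nC: "v \<notin> C" "p \<notin> C" using irr by (auto simp: C_def)
    from z show False
    proof
      assume z: "set zs \<subseteq> C \<union> X1"
      have "C \<union> X1 \<subseteq> N v" "p \<notin> C \<union> X1" "C \<subseteq> N p" using X1 nC by (auto simp: C_def)
      then show False using seven[OF zs _ vp] z by blast
    next
      assume z: "set zs \<subseteq> C \<union> X2"
      have "C \<union> X2 \<subseteq> N p" "v \<notin> C \<union> X2" "C \<subseteq> N v" using X2 nC by (auto simp: C_def)
      then show False using seven[OF zs _ sym[OF vp]] z by blast
    qed
  next
    show "E y x" if "E x y" for x y using that by (rule sym)
  qed (use irr finC finX dsj X1 X2 cC k8 in \<open>auto simp: D_def\<close>)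
  show False by (rule contradiction)
qed

lemma card_N_Int_ge: assumes "A \<subseteq> V" shows "card (N x) + card A \<le> card (N x \<inter> A) + card V"
  using card_Int_ge[OF finV N_V assms] by simp

lemma cd_ge: "card (N x) + card (N y) \<le> cd x y + (2 * k + 1)"
  using card_N_Int_ge[OF N_V, of x y] cardV by (simp add: cd_def)

lemma cd_cases: assumes "E x y" shows "cd x y = 5 \<or> k \<le> cd x y"
proof -
  have "x \<in> V" "y \<in> V" using assms inV sym by blast+
  then have "5 \<le> cd x y" using cd_ge[of x y] mindeg[of x] mindeg[of y] by linarith
  moreover have "\<not> (6 \<le> cd x y \<and> cd x y < k)" using codegree_medium[OF assms] by blast
  ultimately show ?thesis by linarith
qed

lemma light_deg: assumes "E x y" "cd x y = 5" shows "card (N x) = k + 3"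
proof -
  have "x \<in> V" "y \<in> V" using assms inV sym by blast+
  then show ?thesis using cd_ge[of x y] mindeg[of x] mindeg[of y] assms(2) by linarith
qed

text \<open>By \<open>card_Un3_ge\<close> the three codegrees add up to at least
  \<open>3 * (k + 3) - (2 * k + 1) = k + 8\<close>. So the third is at least \<open>k - 2\<close>,
  which exceeds 5, and \<open>cd_cases\<close> lifts it to \<open>k\<close>.\<close>

lemma light_triangle:
  assumes "E x y" "E x z" "E y z" "cd x y = 5" "cd x z = 5"
  shows "k \<le> cd y z"
proof -
  have "x \<in> V" "y \<in> V" "z \<in> V" using assms inV sym by blast+
  then have "k + 8 \<le> cd x y + cd x z + cd y z"
    using card_Un3_ge[OF finV N_V N_V N_V, of x y z] mindeg[of x] mindeg[of y] mindeg[of z] cardV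
    unfolding cd_def by linarith
  then show ?thesis using assms cd_cases[OF assms(3)] k8 by linarith
qed

text \<open>If all codegrees were at least \<open>k\<close>, consider the neighbourhood
  \<open>A\<close> of a vertex \<open>v\<close> of minimum degree. Two disjoint non-adjacent pairs
  in \<open>A\<close> lead to an 8-cycle; without them, removing one non-adjacent pair, if there is
  any, leaves a clique on at least nine vertices.\<close>

lemma light_exists: "\<exists>x y. E x y \<and> cd x y = 5"
proof (rule ccontr)
  assume "\<not> ?thesis"
  then have hv: "k \<le> cd x y" if "E x y" for x y using cd_cases that by blast
  have "V \<noteq> {}" using cardV by auto
  then obtain v where v: "v \<in> V" "\<And>u. u \<in> V \<Longrightarrow> card (N v) \<le> card (N u)"
    using arg_min_if_finite(1)[OF finV, of "\<lambda>u. card (N u)"] arg_min_least[OF finV, of _ "\<lambda>u. card (N u)"]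
    by blast
  define A where "A = N v"
  have d: "k + 3 \<le> card A" using mindeg[OF v(1)] by (simp add: A_def)
  have AV: "A \<subseteq> V" using N_V by (simp add: A_def)
  have finA: "finite A" by (simp add: A_def)
  have no2: False if q: "distinct [a,b,c,d]" "{a,b,c,d} \<subseteq> A" "\<not> E a b" "\<not> E c d" for a b c d
  proof -
    define S where "S = A - {a,b,c,d}"
    have cS: "card S = card A - 4" using q by (simp add: S_def card_Diff_subset)
    have finS: "finite S" using finA by (simp add: S_def)
    \<comment> \<open>Each of the four vertices has at most two neighbours among them. The first
      bound uses the codegree with \<open>v\<close>, the second that the degree of \<open>x\<close>
      is at least that of \<open>v\<close>.\<close>
    have ge: "k - 2 \<le> card (N x \<inter> S) \<and> 2 * card A \<le> card (N x \<inter> S) + (2 * k + 3)"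
      if x: "x \<in> {a,b,c,d}" for x
    proof -
      obtain y z where yz: "N x \<inter> {a,b,c,d} \<subseteq> {y, z}" "card {y,z} \<le> 2" "y \<in> V" "z \<in> V"
        proof -
        have V4: "a \<in> V" "b \<in> V" "c \<in> V" "d \<in> V" using q(2) AV by auto
        have "card {a,b} \<le> 2" "card {c,d} \<le> 2" by (simp_all add: card_insert_if)
        moreover have "N x \<inter> {a,b,c,d} \<subseteq> {c,d} \<or> N x \<inter> {a,b,c,d} \<subseteq> {a,b}"
          using x q(3,4) irr E_comm[of a b] E_comm[of c d] by auto
        ultimately show thesis using that[of c d] that[of a b] V4 by blast
      qed
      have "card (N x \<inter> A) \<le> card (N x \<inter> S \<union> {y, z})"
        using yz(1) finS by (intro card_mono) (auto simp: S_def)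
      also have "\<dots> \<le> card (N x \<inter> S) + 2" using yz(2) card_Un_le[of "N x \<inter> S" "{y,z}"] by linarith
      finally have 1: "card (N x \<inter> A) \<le> card (N x \<inter> S) + 2" .
      have "k \<le> card (N x \<inter> A)"
        using hv[of v x] x q(2) by (auto simp: A_def cd_def Int_commute)
      moreover have "card A \<le> card (N x)" using v(2) x q(2) AV by (auto simp: A_def)
      then have "2 * card A \<le> card (N x \<inter> A) + (2 * k + 1)"
        using card_N_Int_ge[OF AV, of x] cardV by linarith
      ultimately show ?thesis using 1 by linarith
    qed
    \<comment> \<open>For \<open>card A\<close> up to \<open>2 * k - 4\<close> the first bound of
      \<open>ge\<close> suffices, beyond that the second.\<close>
    have pair: "4 \<le> card (N x \<inter> N y \<inter> S)" if xy: "x \<in> {a,b,c,d}" "y \<in> {a,b,c,d}" for x y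
    proof -
      have "card (N x \<inter> S) + card (N y \<inter> S) \<le> card ((N x \<inter> S) \<inter> (N y \<inter> S)) + card S"
        by (rule card_Int_ge[OF finS]) auto
      moreover have "(N x \<inter> S) \<inter> (N y \<inter> S) = N x \<inter> N y \<inter> S" by auto
      ultimately show ?thesis using ge[OF xy(1)] ge[OF xy(2)] cS d k8 by (cases "card A \<le> 2 * k - 4") auto
    qed
    have "has_c8 E A"
      using q pair[of a b] pair[of b c] pair[of c d] pair[of d a]
      by (intro zigzag_c8[of a b c d A S]) (auto simp: S_def)
    then show False using no_wheel by (simp add: A_def)
  qed
  obtain B where B: "B \<subseteq> A" "card B \<ge> 9" "\<And>x y. x \<in> B \<Longrightarrow> y \<in> B \<Longrightarrow> x \<noteq> y \<Longrightarrow> E x y"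
  proof (cases "\<exists>x \<in> A. \<exists>y \<in> A. x \<noteq> y \<and> \<not> E x y")
    case True
    then obtain x y where xy: "x \<in> A" "y \<in> A" "x \<noteq> y" "\<not> E x y" by blast
    show thesis
    proof (rule that[of "A - {x, y}"])
      show "9 \<le> card (A - {x,y})" using xy d k8 by (simp add: card_Diff_subset)
      show "E u w" if "u \<in> A - {x,y}" "w \<in> A - {x,y}" "u \<noteq> w" for u w
        using no2[of x y u w] that xy by auto
    qed auto
  next
    case False
    then show thesis using that[of A] d k8 by auto
  qed
  have "finite B" using B(1) finA finite_subset by blast
  then obtain zs where zs: "set zs = B" "distinct zs" using finite_distinct_list by blast
  define ys where "ys = take 8 zs"
  have ys: "length ys = 8" "distinct ys" "set ys \<subseteq> B"
    using zs B(2) distinct_card[OF zs(2)] set_take_subset[of 8 zs] by (auto simp: ys_def)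
  have c: "E (ys ! i) (ys ! j)" if "i < 8" "j < 8" "i \<noteq> j" for i j
    using B(3) ys that by (metis nth_eq_iff_index_eq nth_mem subsetD)
  have "successively E ys"
    unfolding successively_conv_nth using c ys(1) by auto
  moreover have "ys \<noteq> []" using ys(1) by auto
  then have "E (last ys) (hd ys)" using c[of 7 0] ys(1) by (simp add: last_conv_nth hd_conv_nth)
  ultimately have "has_c8 E A" unfolding has_c8_def using ys B(1) by blast
  then show False using no_wheel by (simp add: A_def)
qed

text \<open>The light edge makes the degree of \<open>v\<close> exactly \<open>k + 3\<close>. Each
  of four heavy neighbours then misses at most two of the remaining \<open>k - 1\<close> neighbours
  of \<open>v\<close>, so any two of them have three common neighbours there, and
  \<open>zigzag_c8\<close> applies once some pair has four.\<close>

lemma heavy_le_3: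
  assumes "E v a" "cd v a = 5"
  shows "card {y \<in> N v. k \<le> cd v y} \<le> 3"
proof (rule ccontr)
  let ?L = "{y \<in> N v. k \<le> cd v y}"
  assume "\<not> ?thesis"
  then have "4 \<le> card ?L" by simp
  then obtain Q where Q: "Q \<subseteq> ?L" "card Q = 4" by (meson obtain_subset_with_card_n)
  have finQ: "finite Q" using Q(2) card.infinite by fastforce
  define A where "A = N v"
  define S where "S = A - Q"
  have cA: "card A = k + 3" using light_deg[OF assms] by (simp add: A_def)
  have finA: "finite A" by (simp add: A_def)
  have QA: "Q \<subseteq> A" using Q by (auto simp: A_def)
  have cS: "card S = k - 1" "finite S" using QA Q(2) cA finQ finA by (auto simp: S_def card_Diff_subset)
  have ge: "card S \<le> card (N x \<inter> S) + 2" "card (S - N x) \<le> 2" if "x \<in> Q" for x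
  proof -
    have "card (N x \<inter> A) \<le> card (N x \<inter> S \<union> (Q - {x}))"
      using cS finQ irr by (intro card_mono) (auto simp: S_def)
    also have "\<dots> \<le> card (N x \<inter> S) + card (Q - {x})" by (rule card_Un_le)
    also have "card (Q - {x}) = 3" using Q(2) that by simp
    finally have "card (N x \<inter> A) \<le> card (N x \<inter> S) + 3" .
    moreover have "k \<le> card (N x \<inter> A)" using that Q(1) by (auto simp: A_def cd_def Int_commute)
    ultimately show 1: "card S \<le> card (N x \<inter> S) + 2" using cS by linarith
    have "card (S - N x) = card S - card (N x \<inter> S)"
      using cS(2) by (simp add: card_Diff_subset_Int Int_commute)
    then show "card (S - N x) \<le> 2" using 1 by simp
  qed
  have pair: "card (N x \<inter> N y \<inter> S) = card S - card ((S - N x) \<union> (S - N y))" for x y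
  proof -
    have "N x \<inter> N y \<inter> S = S - ((S - N x) \<union> (S - N y))" by auto
    then show ?thesis using cS(2) by (metis Un_Diff card_Diff_subset Diff_subset Un_least finite_Diff finite_UnI)
  qed
  have p3: "3 \<le> card (N x \<inter> N y \<inter> S)" if "x \<in> Q" "y \<in> Q" for x y
    using pair[of x y] card_Un_le[of "S - N x" "S - N y"] ge(2)[OF that(1)] ge(2)[OF that(2)] cS k8
    by simp
  \<comment> \<open>Otherwise \<open>k = 8\<close> and the four sets of missed vertices are disjoint
    pairs, eight elements in the seven-element set \<open>S\<close>.\<close>
  have "\<exists>x \<in> Q. \<exists>y \<in> Q. x \<noteq> y \<and> 4 \<le> card (N x \<inter> N y \<inter> S)"
  proof (rule ccontr)
    assume neg: "\<not> ?thesis"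
    have small: "card (N x \<inter> N y \<inter> S) \<le> 3" if "x \<in> Q" "y \<in> Q" "x \<noteq> y" for x y
    proof -
      have "\<not> 4 \<le> card (N x \<inter> N y \<inter> S)" using that neg by blast
      then show ?thesis by simp
    qed
    have dj: "card (S - N x) = 2 \<and> k = 8 \<and> (S - N x) \<inter> (S - N y) = {}" if "x \<in> Q" "y \<in> Q" "x \<noteq> y" for x y
    proof -
      have "card (S - N x) + card (S - N y) = card ((S - N x) \<union> (S - N y)) + card ((S - N x) \<inter> (S - N y))"
        using cS(2) by (intro card_Un_Int) auto
      then have "card ((S - N x) \<inter> (S - N y)) = 0 \<and> card (S - N x) = 2 \<and> k = 8"
        using small[OF that] pair[of x y] ge(2)[OF that(1)] ge(2)[OF that(2)] cS(1) k8 by linarith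
      then show ?thesis using cS(2) by auto
    qed
    have ex2: "\<exists>y \<in> Q. x \<noteq> y" if "x \<in> Q" for x
      using ex_in_diff[of "{x}" Q] Q(2) by auto
    have "card (\<Union>x\<in>Q. S - N x) = (\<Sum>x\<in>Q. card (S - N x))"
      using finQ cS(2) dj by (intro card_UN_disjoint) auto
    also have "\<dots> = (\<Sum>x\<in>Q. 2)" using dj ex2 by (intro sum.cong refl) blast
    also have "\<dots> = 8" using Q(2) by simp
    finally have "8 \<le> card S" using card_mono[OF cS(2), of "\<Union>x\<in>Q. S - N x"] by auto
    moreover obtain x where "x \<in> Q" using Q(2) by fastforce
    then have "k = 8" using ex2 dj by blast
    ultimately show False using cS by simp
  qed
  then obtain a b where ab: "a \<in> Q" "b \<in> Q" "a \<noteq> b" "4 \<le> card (N a \<inter> N b \<inter> S)" by blast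
  obtain c where c: "c \<in> Q" "c \<notin> {a,b}" using ex_in_diff[of "{a,b}" Q] Q(2) ab(3) by auto
  obtain d where d: "d \<in> Q" "d \<notin> {a,b,c}" using ex_in_diff[of "{a,b,c}" Q] Q(2) ab(3) c by auto
  have "has_c8 E A"
    using ab c d QA p3[of b c] p3[of c d] p3[of d a] by (intro zigzag_c8[of a b c d A S]) (auto simp: S_def)
  then show False using no_wheel by (simp add: A_def)
qed

end

context wheel_free
begin

lemma c8I: "length zs = 8 \<Longrightarrow> distinct zs \<Longrightarrow> set zs \<subseteq> N h \<Longrightarrow> successively E zs \<Longrightarrow>
   E (last zs) (hd zs) \<Longrightarrow> False"
  using no_wheel[of h] unfolding has_c8_def by blast

lemma split_label:
  fixes P :: "'b \<Rightarrow> 'c \<Rightarrow> bool"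
  assumes "card {x \<in> S. \<not> P x l} \<le> 2" "finite S" "{a,b,c} \<subseteq> S" "distinct [a,b,c]"
  shows "P a l \<or> P b l \<or> P c l"
proof (rule ccontr)
  assume "\<not> ?thesis"
  then have "{a,b,c} \<subseteq> {x \<in> S. \<not> P x l}" using assms by auto
  then have "card {a,b,c} \<le> 2" using assms(1,2) card_mono[of "{x \<in> S. \<not> P x l}" "{a,b,c}"] by simp
  then show False using assms(4) by simp
qed

text \<open>\<open>L\<close> and \<open>B\<close> are the heavy and the light neighbours of a vertex
  \<open>v\<close> that has a light edge. An edge within \<open>B\<close> lies in a triangle with
  two light edges at \<open>v\<close>, so it is heavy; hence degrees within \<open>B\<close> are at
  most 3. A vertex of \<open>B\<close> has exactly five neighbours in \<open>A\<close>, so at least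
  two in \<open>L\<close>. The 8-cycle strings together pieces of \<open>B\<close> by means of
  \<open>L\<close>.\<close>

lemma wheel_free_contradiction: False
proof -
  obtain v a where va: "E v a" "cd v a = 5" using light_exists by blast
  define A where "A = N v"
  define L where "L = {y \<in> N v. k \<le> cd v y}"
  define B where "B = A - L"
  have cA: "card A = k + 3" using light_deg[OF va] by (simp add: A_def)
  have LA: "L \<subseteq> A" by (auto simp: L_def A_def)
  have "finite A" by (simp add: A_def)
  then have fin: "finite A" "finite L" "finite B"
    using finite_subset[OF LA] by (simp_all add: B_def)
  have L3: "card L \<le> 3" using heavy_le_3[OF va] by (simp add: L_def)
  have cB: "card B = k + 3 - card L" using cA LA fin by (simp add: B_def card_Diff_subset)
  have A: "A = L \<union> B" "L \<inter> B = {}" using LA by (auto simp: B_def)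
  have light: "E v u" "cd v u = 5" if "u \<in> B" for u
    using that cd_cases by (auto simp: B_def A_def L_def)
  have degB: "card (N u \<inter> B) \<le> 3" if u: "u \<in> B" for u
  proof -
    have "N u \<inter> B \<subseteq> {y \<in> N u. k \<le> cd u y}"
      using light[OF u] light light_triangle[of v u] by auto
    moreover have "finite {y \<in> N u. k \<le> cd u y}" by (rule finite_subset[OF _ finN[of u]]) auto
    ultimately have "card (N u \<inter> B) \<le> card {y \<in> N u. k \<le> cd u y}" by (intro card_mono)
    also have "\<dots> \<le> 3" using heavy_le_3[of u v] light[OF u] sym[of v u] cd_comm[of u v] by simp
    finally show ?thesis .
  qed
  have deg5: "card (N u \<inter> L) + card (N u \<inter> B) = 5" if u: "u \<in> B" for u
  proof -
    have "N u \<inter> A = (N u \<inter> L) \<union> (N u \<inter> B)" using A by auto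
    then have "card (N u \<inter> A) = card (N u \<inter> L) + card (N u \<inter> B)"
      using fin A by (simp add: card_Un_disjoint Int_Un_distrib disjoint_iff)
    then show ?thesis using light(2)[OF u] by (simp add: cd_def A_def Int_commute)
  qed
  have LN: "card (N u \<inter> L) \<le> card L" for u using fin by (intro card_mono) auto
  have "B \<noteq> {}" using cB L3 k8 by auto
  then obtain u where u: "u \<in> B" by blast
  have "2 \<le> card L" using deg5[OF u] degB[OF u] LN[of u] by linarith
  then consider "card L = 2" | "card L = 3" using L3 by linarith
  then show False
  proof cases
    case 1
    then obtain p q where pq: "L = {p, q}" "p \<noteq> q" by (auto simp: card_2_iff)
    have full: "E u p" "E u q" "card (N u \<inter> B) = 3" if u: "u \<in> B" for u
    proof -
      have c: "card (N u \<inter> L) = 2" "card (N u \<inter> B) = 3"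
        using deg5[OF u] degB[OF u] LN[of u] 1 by linarith+
      then have "N u \<inter> L = L" using 1 fin by (intro card_subset_eq) auto
      then show "E u p" "E u q" "card (N u \<inter> B) = 3" using pq c by auto
    qed
    obtain y z where yz: "y \<in> N u \<inter> B" "z \<in> N u \<inter> B" "y \<noteq> z"
      using ex_distinct2[of "N u \<inter> B"] full(3)[OF u] by auto
    define F where "F = B - {u,y,z}"
    have nu: "u \<noteq> y" "u \<noteq> z" using yz irr by auto
    have cF: "card F = card B - 3" using u yz nu fin by (simp add: F_def card_Diff_subset)
    have finF: "finite F" using fin by (simp add: F_def)
    \<comment> \<open>Otherwise each of the at least six vertices of \<open>F\<close> sends two
      edges to \<open>u\<close>, \<open>y\<close>, \<open>z\<close>, which together can receive only
      nine.\<close>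
    have "\<exists>x \<in> F. 2 \<le> card (N x \<inter> F)"
    proof (rule ccontr)
      assume neg: "\<not> ?thesis"
      have two: "2 \<le> card (N x \<inter> {u,y,z})" if x: "x \<in> F" for x
      proof -
        have "N x \<inter> B \<subseteq> (N x \<inter> F) \<union> (N x \<inter> {u,y,z})" by (auto simp: F_def)
        then have "card (N x \<inter> B) \<le> card ((N x \<inter> F) \<union> (N x \<inter> {u,y,z}))"
          using finF by (intro card_mono) auto
        also have "\<dots> \<le> card (N x \<inter> F) + card (N x \<inter> {u,y,z})" by (rule card_Un_le)
        finally show ?thesis using neg x full(3)[of x] by (force simp: F_def)
      qed
      have "2 * card F \<le> (\<Sum>x\<in>F. card (N x \<inter> {u,y,z}))"
        using sum_bounded_below[of F 2 "\<lambda>x. card (N x \<inter> {u,y,z})"] two by (simp add: mult.commute)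
      also have "\<dots> = (\<Sum>b\<in>{u,y,z}. card (N b \<inter> F))" using finF by (intro double_count) auto
      also have "\<dots> \<le> 9"
      proof -
        have "card (N b \<inter> F) \<le> 3" if "b \<in> B" for b
          using degB[OF that] card_mono[of "N b \<inter> B" "N b \<inter> F"] by (force simp: F_def)
        then have "card (N u \<inter> F) \<le> 3" "card (N y \<inter> F) \<le> 3" "card (N z \<inter> F) \<le> 3" using u yz by auto
        then show ?thesis using nu yz(3) by simp
      qed
      finally show False using cF cB 1 k8 by simp
    qed
    then obtain x where x: "x \<in> F" "2 \<le> card (N x \<inter> F)" by blast
    then obtain y' z' where yz': "y' \<in> N x \<inter> F" "z' \<in> N x \<inter> F" "y' \<noteq> z'"
      using ex_distinct2 by blast
    have xx: "x \<noteq> y'" "x \<noteq> z'" using yz' irr by auto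
    have inB: "{u,y,z,x,y',z'} \<subseteq> B" using u yz x yz' by (auto simp: F_def)
    have d6: "distinct [u,y,z,x,y',z']" using nu yz(3) x(1) yz' xx by (auto simp: F_def)
    have pB: "p \<notin> B" "q \<notin> B" using pq by (auto simp: B_def)
    \<comment> \<open>The disjoint paths \<open>y, u, z\<close> and \<open>y', x, z'\<close> in
      \<open>B\<close> are linked by \<open>p\<close> and \<open>q\<close>, which are adjacent to
      all of \<open>B\<close>.\<close>
    show False
    proof (rule c8I[of "[p,y,u,z,q,y',x,z']" v])
      show "distinct [p,y,u,z,q,y',x,z']" using d6 pq(2) pB inB by auto
      show "set [p,y,u,z,q,y',x,z'] \<subseteq> N v" using inB pq LA unfolding A_def[symmetric] A(1) by auto
      have "E p y" "E z q" "E q y'" "E z' p" using sym[OF full(1)[of y]] full(2)[of z] sym[OF full(2)[of y']] full(1)[of z'] inB by auto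
      moreover have "E y u" "E u z" "E y' x" "E x z'" using yz yz' by (auto simp: E_comm)
      ultimately show "successively E [p,y,u,z,q,y',x,z']"
        "E (last [p,y,u,z,q,y',x,z']) (hd [p,y,u,z,q,y',x,z'])" by auto
    qed simp
  next
    case 2
    \<comment> \<open>Of the \<open>k + 3\<close> vertices of \<open>A\<close>, at least
      \<open>k\<close> are neighbours of \<open>l\<close>, and \<open>l\<close> itself is
      not.\<close>
    have miss: "card {x \<in> B. \<not> E x l} \<le> 2" if l: "l \<in> L" for l
    proof -
      have "k \<le> card (N l \<inter> A)" using l by (auto simp: L_def A_def cd_def Int_commute)
      moreover have "card ((N l \<inter> A) \<union> insert l {x \<in> B. \<not> E x l}) \<le> card A"
        using fin l LA A by (intro card_mono) auto
      moreover have "card ((N l \<inter> A) \<union> insert l {x \<in> B. \<not> E x l}) =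
          card (N l \<inter> A) + card (insert l {x \<in> B. \<not> E x l})"
        using fin irr by (intro card_Un_disjoint) (auto simp: E_comm)
      moreover have "card (insert l {x \<in> B. \<not> E x l}) = Suc (card {x \<in> B. \<not> E x l})"
        using fin l A by (intro card_insert_disjoint) auto
      ultimately show ?thesis using cA by linarith
    qed
    obtain p q r where pqr: "L = {p,q,r}" "p \<noteq> q" "p \<noteq> r" "q \<noteq> r"
      using 2 by (auto simp: card_3_iff)
    have deg2: "2 \<le> card (N x \<inter> L)" "2 \<le> card (N x \<inter> B)" if "x \<in> B" for x
      using deg5[OF that] degB[OF that] LN[of x] 2 by linarith+
    have "\<exists>z \<in> B. E z p \<and> E z q \<and> E z r"
    proof (rule ccontr)
      assume "\<not> ?thesis"
      then have "B \<subseteq> {x \<in> B. \<not> E x p} \<union> {x \<in> B. \<not> E x q} \<union> {x \<in> B. \<not> E x r}" by auto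
      then have "card B \<le> card ({x \<in> B. \<not> E x p} \<union> {x \<in> B. \<not> E x q} \<union> {x \<in> B. \<not> E x r})"
        using fin by (intro card_mono) auto
      also have "\<dots> \<le> card {x \<in> B. \<not> E x p} + card {x \<in> B. \<not> E x q} + card {x \<in> B. \<not> E x r}"
        by (meson add_le_mono1 card_Un_le order_trans)
      finally show False using miss[of p] miss[of q] miss[of r] pqr cB 2 k8 by simp
    qed
    then obtain z where z: "z \<in> B" "E z p" "E z q" "E z r" by blast
    define F where "F = B - {z}"
    have cF: "card F = k - 1" using cB 2 z fin by (simp add: F_def)
    have nbF: "\<exists>y. y \<in> N x \<inter> F" if x: "x \<in> F" for x
    proof -
      have "x \<in> B" using x by (simp add: F_def)
      from deg2(2)[OF this] obtain y where "y \<in> N x \<inter> B" "y \<notin> {z}"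
        using ex_in_diff[of "{z}" "N x \<inter> B"] by auto
      then show ?thesis by (auto simp: F_def)
    qed
    obtain x where x: "x \<in> F" using cF k8 by fastforce
    obtain x' where x': "x' \<in> N x \<inter> F" using nbF[OF x] by blast
    have "card ((N x \<inter> B) \<union> (N x' \<inter> B)) \<le> 6"
      using card_Un_le[of "N x \<inter> B" "N x' \<inter> B"] degB[of x] degB[of x'] x x' by (simp add: F_def)
    then have "card ((N x \<inter> B) \<union> (N x' \<inter> B)) < card F" using cF k8 by simp
    then obtain y where y: "y \<in> F" "y \<notin> (N x \<inter> B) \<union> (N x' \<inter> B)"
      using ex_in_diff[of "(N x \<inter> B) \<union> (N x' \<inter> B)" F] fin by auto
    obtain y' where y': "y' \<in> N y \<inter> F" using nbF[OF y(1)] by blast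
    have inB: "x \<in> B" "x' \<in> B" "y \<in> B" "y' \<in> B" "z \<in> B" using x x' y y' z by (auto simp: F_def)
    have d5: "distinct [x,x',y,y',z]"
      using x x' y y' irr by (auto simp: F_def E_comm)
    have Exy: "E x x'" "E y y'" using x' y' by auto
    \<comment> \<open>The edge \<open>s s'\<close>, the edge \<open>t t'\<close> and the vertex
      \<open>z\<close> fill the three gaps in the cyclic order \<open>a, b, c\<close> of
      \<open>L\<close>.\<close>
    have cyc: False if "{a,b,c} = L" "distinct [a,b,c]" "(s, s') = (x, x') \<or> (s, s') = (x', x)"
      "(t, t') = (y, y') \<or> (t, t') = (y', y)" "E s a" "E s' b" "E t b" "E t' c" for a b c s s' t t'
    proof (rule c8I[of "[a,s,s',b,t,t',c,z]" v])
      have "a \<in> L" "b \<in> L" "c \<in> L" using that by auto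
      then show "distinct [a,s,s',b,t,t',c,z]" using that d5 inB A(2) by auto
      show "set [a,s,s',b,t,t',c,z] \<subseteq> N v"
        using that(1,3,4) inB unfolding A_def[symmetric] A(1) by auto
      have "E a s" "E b t" "E t' c" "E c z" "E z a" using that z pqr by (auto simp: E_comm)
      moreover have "E s s'" "E t t'" using that(3,4) Exy by (auto simp: E_comm)
      ultimately show "successively E [a,s,s',b,t,t',c,z]"
        "E (last [a,s,s',b,t,t',c,z]) (hd [a,s,s',b,t,t',c,z])" using that by auto
    qed simp
    have row: "E s a \<or> E s b" if "s \<in> B" "{a,b,c} = L" "distinct [a,b,c]" for s a b c
    proof (rule ccontr)
      assume "\<not> ?thesis"
      then have "N s \<inter> L \<subseteq> {c}" using that by auto
      then have "card (N s \<inter> L) \<le> 1" using card_mono[of "{c}"] by fastforce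
      then show False using deg2(1)[OF that(1)] by simp
    qed
    have col: "E s l \<or> E s' l \<or> E s'' l" if "l \<in> L" "{s,s',s''} \<subseteq> B" "distinct [s,s',s'']" for l s s' s''
      using split_label[of B E l, OF miss[OF that(1)] fin(3) that(2,3)] .
    have rows: "E s p \<or> E s q" "E s p \<or> E s r" "E s q \<or> E s r" if "s \<in> {x,x',y,y'}" for s
      using row[of s p q r] row[of s p r q] row[of s q r p] that inB pqr by auto
    have cols: "E x l \<or> E x' l \<or> E y l" "E x l \<or> E x' l \<or> E y' l" "E x l \<or> E y l \<or> E y' l"
       "E x' l \<or> E y l \<or> E y' l" if "l \<in> L" for l
      using col[OF that] inB d5 by auto
    \<comment> \<open>Each end of the edge is adjacent to \<open>a\<close> or \<open>b\<close>, and
      each of \<open>a\<close>, \<open>b\<close> to an end: Hall's condition for matching two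
      vertices with two.\<close>
    have link: "E s a \<and> E s' b \<or> E s' a \<and> E s b"
      if ss: "(s, s') = (x, x') \<or> (s, s') = (y, y')" and abc: "{a,b,c} = L" "distinct [a,b,c]"
        "E s a \<or> E s' a" "E s b \<or> E s' b" for a b c s s'
      using row[of s a b c] row[of s' a b c] that inB by auto
    show False
    proof -
      \<comment> \<open>The edge \<open>x x'\<close> has to reach the first two elements of
        \<open>L\<close> and \<open>y y'\<close> the last two. Each edge reaches two of any three
        elements (\<open>one\<close>), and each element is reached by some edge (\<open>e\<close>).
        An element missed by \<open>x x'\<close> is put last, one missed by \<open>y y'\<close>
        first.\<close>
      have "\<exists>a b c. {a,b,c} = L \<and> distinct [a,b,c] \<and> (E x a \<or> E x' a) \<and> (E x b \<or> E x' b) \<and>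
          (E y b \<or> E y' b) \<and> (E y c \<or> E y' c)"
      proof -
        have e: "(E x l \<or> E x' l) \<or> (E y l \<or> E y' l)" if "l \<in> L" for l using cols[OF that] by blast
        have one: "(E x l \<or> E x' l) \<or> (E x m \<or> E x' m)" "(E y l \<or> E y' l) \<or> (E y m \<or> E y' m)"
          if "l \<in> L" "m \<in> L" "l \<noteq> m" for l m
          using rows[of x] rows[of y] that pqr by auto
        consider "\<exists>l\<in>L. \<not> (E x l \<or> E x' l)" | "\<exists>l\<in>L. \<not> (E y l \<or> E y' l)"
          | "\<forall>l\<in>L. (E x l \<or> E x' l) \<and> (E y l \<or> E y' l)" by blast
        then show ?thesis
        proof cases
          case 1
          then obtain c where c: "c \<in> L" "\<not> (E x c \<or> E x' c)" by blast
          obtain a b where ab: "{a,b,c} = L" "distinct [a,b,c]"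
            using c(1) pqr by (cases "c = p"; cases "c = q") fastforce+
          have "E y c \<or> E y' c" using e[OF c(1)] c by blast
          moreover have "E x a \<or> E x' a" "E x b \<or> E x' b" using one(1)[of a c] one(1)[of b c] c ab by auto
          moreover have "(E y a \<or> E y' a) \<or> (E y b \<or> E y' b)" using one(2)[of a b] ab by auto
          moreover have "{b,a,c} = L" "distinct [b,a,c]" using ab by auto
          ultimately show ?thesis using ab by blast
        next
          case 2
          then obtain a where a: "a \<in> L" "\<not> (E y a \<or> E y' a)" by blast
          obtain b c where bc: "{a,b,c} = L" "distinct [a,b,c]"
            using a(1) pqr by (cases "a = p"; cases "a = q") fastforce+
          have "E x a \<or> E x' a" using e[OF a(1)] a by blast
          moreover have "E y b \<or> E y' b" "E y c \<or> E y' c" using one(2)[of b a] one(2)[of c a] a bc by auto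
          moreover have "(E x b \<or> E x' b) \<or> (E x c \<or> E x' c)" using one(1)[of b c] bc by auto
          moreover have "{a,c,b} = L" "distinct [a,c,b]" using bc by auto
          ultimately show ?thesis using bc by blast
        next
          case 3
          have "{p,q,r} = L" "distinct [p,q,r]" "p \<in> L" "q \<in> L" "r \<in> L" using pqr by auto
          then show ?thesis using 3 by blast
        qed
      qed
      then obtain a b c where abc: "{a,b,c} = L" "distinct [a,b,c]" "E x a \<or> E x' a" "E x b \<or> E x' b"
        "E y b \<or> E y' b" "E y c \<or> E y' c" by blast
      have bca: "{b,c,a} = L" "distinct [b,c,a]" using abc by auto
      have l1: "E x a \<and> E x' b \<or> E x' a \<and> E x b" using link[of x x' a b c] abc by blast
      have l2: "E y b \<and> E y' c \<or> E y' b \<and> E y c" using link[of y y' b c a] abc bca by blast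
      from l1 obtain s s' where s: "(s, s') = (x, x') \<or> (s, s') = (x', x)" "E s a" "E s' b" by blast
      from l2 obtain t t' where t: "(t, t') = (y, y') \<or> (t, t') = (y', y)" "E t b" "E t' c" by blast
      show False by (rule cyc[OF abc(1,2) s(1) t(1) s(2,3) t(2,3)])
    qed
  qed
qed

end

section \<open>Graphs without the trees\<close>

definition co_rel :: "'a set \<Rightarrow> ('a \<Rightarrow> 'a \<Rightarrow> bool) \<Rightarrow> 'a \<Rightarrow> 'a \<Rightarrow> bool" where
  "co_rel V R x y \<longleftrightarrow> x \<in> V \<and> y \<in> V \<and> x \<noteq> y \<and> \<not> R x y"

locale co_wheel_free =
  fixes V :: "'a set" and R :: "'a \<Rightarrow> 'a \<Rightarrow> bool" and n :: nat
  assumes finV: "finite V"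
    and R_sym: "R x y \<Longrightarrow> R y x"
    and R_irr: "\<not> R x x"
    and R_V: "R x y \<Longrightarrow> x \<in> V"
    and cardV: "card V = 2 * n - 1"
    and n9: "9 \<le> n" and odd_n: "odd n"
    and no_wheel: "\<not> has_c8 (co_rel V R) {y. co_rel V R h y}"
begin

abbreviation E :: "'a \<Rightarrow> 'a \<Rightarrow> bool" where "E \<equiv> co_rel V R"

sublocale G: simple_graph V R
  using finV R_sym R_irr R_V by unfold_locales

sublocale H: simple_graph V E
  using finV R_sym by unfold_locales (auto simp: co_rel_def)

text \<open>Otherwise all degrees in the complement are at least
  \<open>2 * n - 2 - (n - 4) = (n - 1) + 3\<close>, which is the situation of
  \<open>wheel_free\<close> with \<open>k = n - 1\<close>.\<close>

lemma large_degree: obtains v where "v \<in> V" "n - 3 \<le> card (G.N v)"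
proof (rule ccontr)
  note found = that
  assume no: "\<not> thesis"
  have small: "card (G.N v) < n - 3" if "v \<in> V" for v
  proof (rule ccontr)
    assume "\<not> ?thesis"
    then have "n - 3 \<le> card (G.N v)" by simp
    with found[OF that] no show False by blast
  qed
  have "wheel_free V E (n - 1)"
  proof
    show "card V = 2 * (n - 1) + 1" using cardV n9 by simp
    show "8 \<le> n - 1" using n9 by simp
    show "n - 1 + 3 \<le> card (H.N x)" if x: "x \<in> V" for x
    proof -
      have "H.N x = V - insert x (G.N x)" using x by (auto simp: co_rel_def)
      moreover have "card (insert x (G.N x)) = Suc (card (G.N x))" using R_irr by simp
      ultimately have "card (H.N x) = 2 * n - 1 - Suc (card (G.N x))"
        using G.N_V x cardV by (simp add: card_Diff_subset)
      then show ?thesis using small[OF x] by linarith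
    qed
    show "\<not> has_c8 E (H.N h)" for h using no_wheel by (simp add: H.N_def)
  qed
  then interpret wheel_free V E "n - 1" .
  show False by (rule wheel_free_contradiction)
qed

lemma card_le_3: "card {a,b,c :: 'b} \<le> 3"
  by (simp add: card_insert_if)

lemma card_Diff2_ge: "finite A \<Longrightarrow> card A - 2 \<le> card (A - {x, y :: 'b})"
  using diff_card_le_card_Diff[of "{x,y}" A] by (simp add: card_insert_if split: if_splits)

text \<open>The rim alternates between \<open>P\<close> and \<open>Q\<close>. All wheels below come
  from this lemma, except the one in \<open>almost_complete\<close>.\<close>

lemma complete_bipartite:
  assumes "P \<subseteq> H.N h" "Q \<subseteq> H.N h" "4 \<le> card P" "4 \<le> card Q" "\<And>p q. p \<in> P \<Longrightarrow> q \<in> Q \<Longrightarrow> E p q"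
  shows False
proof -
  obtain ps where ps: "length ps = 4" "distinct ps" "set ps \<subseteq> P" using ex_distinct_list[OF assms(3)] by blast
  obtain qs where qs: "length qs = 4" "distinct qs" "set qs \<subseteq> Q" using ex_distinct_list[OF assms(4)] by blast
  obtain a b c d where p: "ps = [a,b,c,d]" using list_of_length(2)[OF ps(1)] by blast
  obtain a' b' c' d' where q: "qs = [a',b',c',d']" using list_of_length(2)[OF qs(1)] by blast
  have in_P: "a \<in> P" "b \<in> P" "c \<in> P" "d \<in> P" using ps p by auto
  have in_Q: "a' \<in> Q" "b' \<in> Q" "c' \<in> Q" "d' \<in> Q" using qs q by auto
  have ne: "x \<noteq> y" if "x \<in> P" "y \<in> Q" for x y using assms(5)[OF that] by (auto simp: co_rel_def)
  have "distinct [a,a',b,b',c,c',d,d']" using ps(2) qs(2) p q ne in_P in_Q by auto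
  moreover have "set [a,a',b,b',c,c',d,d'] \<subseteq> H.N h" using in_P in_Q assms(1,2) by auto
  moreover have "successively E [a,a',b,b',c,c',d,d']" "E (last [a,a',b,b',c,c',d,d']) (hd [a,a',b,b',c,c',d,d'])"
    using assms(5) H.sym in_P in_Q by simp_all
  ultimately have "has_c8 E (H.N h)" unfolding has_c8_def
    by (intro exI[of _ "[a,a',b,b',c,c',d,d']"]) simp
  then show False using no_wheel by (simp add: H.N_def)
qed

text \<open>Five vertices of \<open>U\<close> are pairwise adjacent in the complement and adjacent
  there to everything else outside \<open>K\<close>. One is the hub; the other four and four further
  vertices outside \<open>K\<close> give the rim.\<close>

lemma sparse_set:
  assumes U: "U \<subseteq> V" "5 \<le> card U" and K: "card K \<le> 3" "finite K" "K \<inter> U = {}"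
    and nb: "\<And>u. u \<in> U \<Longrightarrow> G.N u \<subseteq> K"
  shows False
proof -
  obtain us where us: "length us = 5" "distinct us" "set us \<subseteq> U" using ex_distinct_list[OF U(2)] by blast
  obtain h a b c d where "us = [h,a,b,c,d]" using list_of_length(3)[OF us(1)] by blast
  then have u: "distinct [h,a,b,c,d]" "{h,a,b,c,d} \<subseteq> U" using us by auto
  let ?Q = "V - (K \<union> {h,a,b,c,d})"
  have nbD: "y \<in> K" if "u \<in> U" "R u y" for u y using nb[OF that(1)] that(2) by auto
  have "card (K \<union> {h,a,b,c,d}) \<le> 8"
    using card_Un_le[of K "{h,a,b,c,d}"] K(1) u(1) by simp
  then have "4 \<le> card ?Q"
    using cardV n9 diff_card_le_card_Diff[of "K \<union> {h,a,b,c,d}" V] K(2) by simp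
  moreover have Q: "E x y" if "x \<in> {h,a,b,c,d}" "y \<in> ?Q" for x y
    using that nbD u U unfolding co_rel_def by blast
  moreover have "{a,b,c,d} \<subseteq> H.N h"
    unfolding H.N_def
  proof clarify
    fix x assume "x \<in> {a,b,c,d}"
    then show "E h x"
    using nbD[of h x] u U K(3) by (auto simp: co_rel_def)
  qed
  moreover have "4 \<le> card {a,b,c,d}" using u by simp
  moreover have "?Q \<subseteq> H.N h"
  proof
    fix y assume "y \<in> ?Q"
    from Q[OF _ this, of h] show "y \<in> H.N h" by simp
  qed
  ultimately show False using complete_bipartite[of "{a,b,c,d}" h ?Q] by blast
qed

lemma finN [simp]: "finite (G.N x)" "finite (H.N x)"
  by simp_all

lemma N_split:
  assumes "S \<subseteq> V" "r \<in> S" shows "card (G.N r \<inter> S) + card (H.N r \<inter> S) = card S - 1"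
proof -
  have "S - {r} = (G.N r \<inter> S) \<union> (H.N r \<inter> S)" using assms R_irr by (auto simp: co_rel_def)
  moreover have "(G.N r \<inter> S) \<inter> (H.N r \<inter> S) = {}" by (auto simp: co_rel_def)
  ultimately have "card (S - {r}) = card (G.N r \<inter> S) + card (H.N r \<inter> S)"
    by (simp add: card_Un_disjoint)
  then show ?thesis using assms finite_subset[OF assms(1) finV] by simp
qed

text \<open>Parity: a graph on \<open>n\<close> vertices cannot be regular of degree \<open>n - 4\<close>, as both are odd.\<close>

lemma not_regular:
  assumes S: "S \<subseteq> V" "card S = n" and low: "\<And>r. r \<in> S \<Longrightarrow> card (H.N r \<inter> S) \<le> 3"
  obtains r where "r \<in> S" "n - 3 \<le> card (G.N r \<inter> S)"
proof (rule ccontr)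
  note found = that
  assume no: "\<not> thesis"
  have finS: "finite S" using S(1) finV finite_subset by blast
  have deg: "card (G.N r \<inter> S) = n - 4" if r: "r \<in> S" for r
  proof -
    have "\<not> n - 3 \<le> card (G.N r \<inter> S)" using no found[OF r] by blast
    then show ?thesis using N_split[OF S(1) r] low[OF r] S(2) by linarith
  qed
  \<comment> \<open>The handshake lemma: adding \<open>x\<close> to the vertex set adds the degree
    of \<open>x\<close> twice.\<close>
  have even_sum: "even (\<Sum>a\<in>T. card (G.N a \<inter> T))" if "finite T" for T
    using that
  proof induction
    case (insert x T)
    have 1: "card (G.N a \<inter> insert x T) = card (G.N a \<inter> T) + card (G.N a \<inter> {x})" if "a \<in> T" for a
    proof -
      have "G.N a \<inter> insert x T = (G.N a \<inter> T) \<union> (G.N a \<inter> {x})" by auto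
      moreover have "(G.N a \<inter> T) \<inter> (G.N a \<inter> {x}) = {}" using insert.hyps by auto
      ultimately show ?thesis using insert.hyps by (simp add: card_Un_disjoint)
    qed
    have 2: "G.N x \<inter> insert x T = G.N x \<inter> T" using R_irr by auto
    have "(\<Sum>a\<in>T. card (G.N a \<inter> {x})) = card (G.N x \<inter> T)"
      using G.double_count[of T "{x}"] insert.hyps by simp
    then have "(\<Sum>a\<in>insert x T. card (G.N a \<inter> insert x T))
        = (\<Sum>a\<in>T. card (G.N a \<inter> T)) + 2 * card (G.N x \<inter> T)"
      using insert.hyps 1 2 by (simp add: sum.distrib)
    then show ?case using insert.IH by simp
  qed simp
  have "(\<Sum>a\<in>S. card (G.N a \<inter> S)) = n * (n - 4)" using deg S(2) by simp
  then have "even (n * (n - 4))" using even_sum[OF finS] by simp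
  then show False using odd_n n9 by simp
qed

text \<open>The hub is \<open>r\<close>, and the rim alternates between \<open>Z\<close> and the
  complement-neighbours of \<open>r\<close> in \<open>S\<close>. In the applications
  \<open>Z\<close> consists of \<open>v\<close> and some of its neighbours in
  \<open>G\<close>.\<close>

lemma complete_to_set:
  assumes S: "S \<subseteq> V" "r \<in> S" "4 \<le> card (H.N r \<inter> S)"
    and Z: "4 \<le> card Z" "\<And>z s. z \<in> Z \<Longrightarrow> s \<in> S \<Longrightarrow> E z s"
  shows False
proof (rule complete_bipartite[of Z r "H.N r \<inter> S"])
  show "Z \<subseteq> H.N r" using Z(2) S(2) H.sym by auto
  show "E p q" if "p \<in> Z" "q \<in> H.N r \<inter> S" for p q using that Z(2) by blast
qed (use S Z in auto)

lemma E_outside: "u \<in> V \<Longrightarrow> s \<in> V \<Longrightarrow> s \<noteq> u \<Longrightarrow> s \<notin> G.N u \<Longrightarrow> E u s"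
  by (auto simp: co_rel_def)

end

section \<open>Graphs without \<open>S_two_one n\<close>\<close>

locale S_two_one_free = co_wheel_free +
  assumes free: "R v u1 \<Longrightarrow> R v u2 \<Longrightarrow> R u1 x1 \<Longrightarrow> R u2 x2 \<Longrightarrow> distinct [v,u1,u2,x1,x2] \<Longrightarrow>
    n - 3 \<le> card ({y. R v y} - {x1, x2}) \<Longrightarrow> False"
begin

text \<open>The excluded tree has centre \<open>v\<close>, adjacent to \<open>n - 3\<close> vertices
  other than \<open>x1\<close>, \<open>x2\<close>; two of these, \<open>u1\<close> and
  \<open>u2\<close>, are continued to \<open>x1\<close> and \<open>x2\<close>.\<close>

lemma free': "R v u1 \<Longrightarrow> R v u2 \<Longrightarrow> R u1 x1 \<Longrightarrow> R u2 x2 \<Longrightarrow> distinct [v,u1,u2,x1,x2] \<Longrightarrow>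
    n - 3 \<le> card (G.N v - {x1, x2}) \<Longrightarrow> False"
  using free[of v u1 u2 x1 x2] by (simp add: G.N_def)

text \<open>Otherwise all degrees of \<open>G\<close> within \<open>S\<close> are at least
  \<open>n - 4\<close>, and by \<open>not_regular\<close> some \<open>w\<close> has at least
  \<open>n - 3\<close> neighbours \<open>T\<close> in \<open>S\<close>. The tree is then found
  around \<open>w\<close>: when \<open>T\<close> has \<open>n - 3\<close>, \<open>n - 2\<close> or
  \<open>n - 1\<close> elements, none, one or two of \<open>x1\<close>, \<open>x2\<close> may lie in
  \<open>T\<close>.\<close>

lemma sparse_vertex:
  assumes S: "S \<subseteq> V" "card S = n"
  obtains r where "r \<in> S" "4 \<le> card (H.N r \<inter> S)"
proof (rule ccontr)
  note found = that
  assume no: "\<not> thesis"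
  have low: "card (H.N r \<inter> S) \<le> 3" if "r \<in> S" for r
  proof -
    have "\<not> 4 \<le> card (H.N r \<inter> S)" using no found[OF that] by blast
    then show ?thesis by simp
  qed
  obtain w where w: "w \<in> S" "n - 3 \<le> card (G.N w \<inter> S)" using not_regular[OF S low] by blast
  have finS: "finite S" using S(1) finV finite_subset by blast
  have deg: "n - 4 \<le> card (G.N r \<inter> S)" if "r \<in> S" for r
    using N_split[OF S(1) that] low[OF that] S(2) by linarith
  define T where "T = G.N w \<inter> S"
  define Q where "Q = S - insert w T"
  have wT: "w \<notin> T" using R_irr by (simp add: T_def)
  have cQ: "card Q = n - 1 - card T" "finite Q"
    using w(1) wT S(2) finS by (simp_all add: Q_def card_Diff_subset T_def)
  have finT: "finite T" by (simp add: T_def)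
  have pick: "\<exists>x \<in> G.N r \<inter> S. x \<notin> K" if "r \<in> S" "card K \<le> 3" "finite K" for r K
    using ex_in_diff[of K "G.N r \<inter> S"] deg[OF that(1)] that(2,3) n9 by linarith
  have TS: "T \<subseteq> S" "\<And>u. u \<in> T \<Longrightarrow> R w u" by (auto simp: T_def)
  have outer: "x \<in> T \<or> x \<in> Q" if "x \<in> S" "x \<noteq> w" for x using that by (auto simp: Q_def)
  have TG: "T - {x,y} \<subseteq> G.N w - {x,y}" for x y by (auto simp: T_def)
  have big: "card (T - {x,y}) \<le> card (G.N w - {x,y})" for x y
    using TG by (intro card_mono) auto
  have Tle: "card T \<le> n - 1" using card_mono[of "S - {w}" T] wT TS finS w(1) S(2) by auto
  consider "card T = n - 3" | "card T = n - 2" | "card T = n - 1" using w(2) Tle by (fold T_def) linarith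
  then show False
  proof cases
    case 1
    then have "2 \<le> card Q" using cQ n9 by simp
    then obtain x1 x2 where x: "x1 \<in> Q" "x2 \<in> Q" "x1 \<noteq> x2" by (rule ex_distinct2)
    have xS: "x1 \<in> S" "x2 \<in> S" "x1 \<noteq> w" "x2 \<noteq> w" "x1 \<notin> T" "x2 \<notin> T" using x by (auto simp: Q_def)
    have "\<not> R x1 w" "\<not> R x2 w" using xS by (auto simp: T_def G.E_comm)
    have Qc: "Q = {x1,x2}"
      using x cQ 1 n9 card_subset_eq[OF cQ(2), of "{x1,x2}"] by simp
    obtain u1 where u1: "u1 \<in> G.N x1 \<inter> S" "u1 \<notin> {x2}" using pick[OF xS(1), of "{x2}"] by auto
    obtain u2 where u2: "u2 \<in> G.N x2 \<inter> S" "u2 \<notin> {x1, u1}"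
      using pick[OF xS(2) card_le_3[of x1 u1 u1]] by auto
    have "u1 \<noteq> w" "u2 \<noteq> w" "u1 \<noteq> x1" "u2 \<noteq> x2"
      using u1 u2 \<open>\<not> R x1 w\<close> \<open>\<not> R x2 w\<close> R_irr by auto
    then have "u1 \<in> T" "u2 \<in> T" using outer[of u1] outer[of u2] u1 u2 Qc by auto
    moreover have "T - {x1,x2} = T" using xS by auto
    ultimately show False
      using free'[of w u1 u2 x1 x2] u1 u2 xS x(3) TS big[of x1 x2] 1 \<open>u1 \<noteq> w\<close> \<open>u2 \<noteq> w\<close> \<open>u1 \<noteq> x1\<close> \<open>u2 \<noteq> x2\<close>
        R_sym[of x1 u1] R_sym[of x2 u2] by auto
  next
    case 2
    then have "card Q = 1" using cQ n9 by simp
    then obtain x1 where Qc: "Q = {x1}" by (auto simp: card_1_singleton_iff)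
    then have xS: "x1 \<in> S" "x1 \<noteq> w" "x1 \<notin> T" by (auto simp: Q_def)
    then have "\<not> R x1 w" by (auto simp: T_def G.E_comm)
    obtain u1 where u1: "u1 \<in> G.N x1 \<inter> S" using pick[OF xS(1), of "{}"] by auto
    have u1': "u1 \<noteq> w" "u1 \<noteq> x1" using u1 \<open>\<not> R x1 w\<close> R_irr by auto
    then have u1T: "u1 \<in> T" using outer[of u1] u1 Qc by auto
    have "card {u1} < card T" using 2 n9 by simp
    then obtain u2 where u2: "u2 \<in> T" "u2 \<noteq> u1" using ex_in_diff[of "{u1}" T] by auto
    have "u2 \<in> S" using u2 TS by auto
    then obtain x2 where x2: "x2 \<in> G.N u2 \<inter> S" "x2 \<notin> {w,x1,u1}" using pick[OF \<open>u2 \<in> S\<close> card_le_3[of w x1 u1]] by auto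
    have "x2 \<noteq> u2" using x2 R_irr by auto
    have "x2 \<in> T" using outer[of x2] x2 Qc by auto
    have "T - {x1, x2} = T - {x2}" using xS by auto
    then have "card (T - {x1,x2}) = n - 3" using \<open>x2 \<in> T\<close> 2 finT by simp
    then show False
      using free'[of w u1 u2 x1 x2] u1 u1' u2 x2 xS TS(2)[OF u1T] TS(2)[OF u2(1)] big[of x1 x2] \<open>x2 \<noteq> u2\<close>
        R_sym[of x1 u1] wT by auto
  next
    case 3
    then have "2 \<le> card T" using n9 by simp
    then obtain u1 u2 where u: "u1 \<in> T" "u2 \<in> T" "u1 \<noteq> u2" by (rule ex_distinct2)
    have uS: "u1 \<in> S" "u2 \<in> S" using u TS by auto
    obtain x1 where x1: "x1 \<in> G.N u1 \<inter> S" "x1 \<notin> {w, u2, u2}" using pick[OF uS(1) card_le_3[of w u2 u2]] by auto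
    obtain x2 where x2: "x2 \<in> G.N u2 \<inter> S" "x2 \<notin> {w, u1, x1}" using pick[OF uS(2) card_le_3[of w u1 x1]] by auto
    have "x1 \<noteq> u1" "x2 \<noteq> u2" using x1 x2 R_irr by auto
    moreover have "n - 3 \<le> card (T - {x1,x2})" using card_Diff2_ge[OF finT, of x1 x2] 3 by simp
    ultimately show False
      using free'[of w u1 u2 x1 x2] u x1 x2 TS(2)[OF u(1)] TS(2)[OF u(2)] big[of x1 x2] wT by auto
  qed
qed

text \<open>The size of \<open>U\<close> determines how many of \<open>x1\<close>, \<open>x2\<close>
  may lie in \<open>U\<close>. In the first two cases one suitable edge \<open>x y\<close> confines
  the neighbours of the rest of \<open>U\<close> to \<open>v\<close>, \<open>x\<close>,
  \<open>y\<close>, and \<open>sparse_set\<close> applies. Otherwise \<open>U\<close> and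
  \<open>W\<close> are joined almost completely in the complement, and \<open>sparse_vertex\<close>
  provides the hub.\<close>

lemma contradiction: False
proof -
  obtain v where v: "v \<in> V" "n - 3 \<le> card (G.N v)" by (rule large_degree)
  define U where "U = G.N v"
  define W where "W = V - insert v U"
  have UV: "U \<subseteq> V" "v \<notin> U" "finite U" using G.N_V R_irr by (auto simp: U_def)
  have cW: "card W = 2 * n - 2 - card U" using UV v cardV by (simp add: W_def card_Diff_subset)
  have WV: "W \<subseteq> V" by (auto simp: W_def)
  have free_v: False if "u1 \<in> U" "u2 \<in> U" "R u1 x1" "R u2 x2" "distinct [u1,u2,x1,x2]" "x1 \<noteq> v" "x2 \<noteq> v"
    "n - 3 \<le> card (U - {x1, x2})" for u1 u2 x1 x2
    using free'[of v u1 u2 x1 x2] that UV by (auto simp: U_def)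
  have sparse: False if nb: "\<And>u. u \<in> U - {x,y} \<Longrightarrow> G.N u \<subseteq> {v,x,y}" and c: "5 \<le> card (U - {x,y})" for x y
    proof (rule sparse_set[OF _ c card_le_3[of v x y]])
    show "U - {x,y} \<subseteq> V" "{v,x,y} \<inter> (U - {x,y}) = {}" using UV by auto
  qed (use nb in auto)
  have vW: "E v s" if "s \<in> W" for s using that v by (intro E_outside) (auto simp: W_def U_def)
  have E_UW: "E u s" if "u \<in> U" "s \<in> W" "\<not> R u s" for u s
    using that UV by (intro E_outside) (auto simp: W_def)
  consider "n - 1 \<le> card U" | "card U = n - 2" | "card U = n - 3" using v(2) by (fold U_def) linarith
  then show False
  proof cases
    case 1
    have c2: "n - 3 \<le> card (U - {x, y})" for x y
      using card_Diff2_ge[OF UV(3), of x y] 1 by simp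
    show False
    proof (cases "\<exists>x\<in>U. \<exists>y. R x y \<and> y \<noteq> v")
      case True
      then obtain x y where xy: "x \<in> U" "R x y" "y \<noteq> v" by blast
      have "G.N u \<subseteq> {v,x,y}" if u: "u \<in> U - {x,y}" for u
      proof
        fix z assume "z \<in> G.N u"
        then show "z \<in> {v,x,y}"
          using free_v[of x u y z] c2[of y z] xy u R_irr by auto
      qed
      moreover have "5 \<le> card (U - {x,y})" using c2[of x y] n9 by linarith
      ultimately show False by (rule sparse)
    next
      case False
      have "5 \<le> card (U - {v,v})" using c2[of v v] n9 by linarith
      moreover have "G.N u \<subseteq> {v,v,v}" if "u \<in> U - {v,v}" for u using that False by auto
      ultimately show False using sparse[of v v] by blast
    qed
  next
    case 2
    show False
    proof (cases "\<exists>x\<in>U. \<exists>y\<in>W. R x y")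
      case True
      then obtain x y where xy: "x \<in> U" "y \<in> W" "R x y" by blast
      have yU: "y \<notin> U" "y \<noteq> v" using xy by (auto simp: W_def)
      have "G.N u \<subseteq> {v,x,y}" if u: "u \<in> U - {x,y}" for u
      proof
        fix z assume z: "z \<in> G.N u"
        have "U - {y, z} = U - {z}" using yU by auto
        moreover have "card U - 1 \<le> card (U - {z})" using UV(3) by (simp add: card_Diff_singleton_if)
        ultimately have "n - 3 \<le> card (U - {y, z})" using 2 by simp
        then show "z \<in> {v,x,y}"
          using free_v[of x u y z] xy u z yU R_irr by auto
      qed
      moreover have "U - {x,y} = U - {x}" using yU by auto
      then have "5 \<le> card (U - {x,y})" using 2 xy UV(3) n9 by simp
      ultimately show False by (rule sparse)
    next
      case False
      have "card W = n" using cW 2 n9 by simp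
      then obtain r where r: "r \<in> W" "4 \<le> card (H.N r \<inter> W)" using sparse_vertex[OF WV] by blast
      have "4 \<le> card (insert v U)" using 2 UV n9 by simp
      then show False using complete_to_set[OF WV r, of "insert v U"] vW E_UW False by auto
    qed
  next
    case 3
    have cW1: "card W = n + 1" using cW 3 n9 by simp
    \<comment> \<open>Two disjoint edges of \<open>G\<close> between \<open>U\<close> and
      \<open>W\<close> would give the tree, so deleting the ends of one removes all of them. If
      there is none, any \<open>x\<close> and \<open>y\<close> are deleted, so that \<open>n\<close>
      vertices of \<open>W\<close> remain in either case.\<close>
    obtain x y where xy: "x \<in> U" "y \<in> W" "\<And>u s. u \<in> U - {x} \<Longrightarrow> s \<in> W - {y} \<Longrightarrow> \<not> R u s"
    proof (cases "\<exists>x\<in>U. \<exists>y\<in>W. R x y")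
      case True
      then obtain x y where xy: "x \<in> U" "y \<in> W" "R x y" by blast
      show thesis
      proof (rule that[OF xy(1,2)])
        fix u s assume u: "u \<in> U - {x}" "s \<in> W - {y}"
        have "U - {y, s} = U" using xy u by (auto simp: W_def)
        then show "\<not> R u s" using free_v[of x u y s] xy u 3 by (auto simp: W_def)
      qed
    next
      case False
      obtain x where "x \<in> U" using 3 n9 by fastforce
      moreover obtain y where "y \<in> W" using cW1 by fastforce
      ultimately show thesis using that False by blast
    qed
    have "card (W - {y}) = n" using cW1 xy(2) WV finite_subset[OF _ finV] by simp
    moreover have WV': "W - {y} \<subseteq> V" using WV by auto
    ultimately obtain r where r: "r \<in> W - {y}" "4 \<le> card (H.N r \<inter> (W - {y}))"
      using sparse_vertex by blast
    have c4: "4 \<le> card (insert v (U - {x}))" using 3 UV n9 xy(1) by simp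
    have "E z s" if "z \<in> insert v (U - {x})" "s \<in> W - {y}" for z s
      using that vW E_UW xy(3) by blast
    then show False by (rule complete_to_set[OF WV' r c4])
  qed
qed

end

section \<open>Graphs without \<open>S_three n\<close>\<close>

locale S_three_free = co_wheel_free +
  assumes free: "R v u \<Longrightarrow> R u x1 \<Longrightarrow> R u x2 \<Longrightarrow> distinct [v,u,x1,x2] \<Longrightarrow>
    n - 3 \<le> card ({y. R v y} - {x1, x2}) \<Longrightarrow> False"
begin

text \<open>Here \<open>v\<close> is the centre of the large star and \<open>u\<close> that of the
  small one; \<open>u\<close> is counted among the \<open>n - 3\<close> neighbours of
  \<open>v\<close>.\<close>

lemma free': "R v u \<Longrightarrow> R u x1 \<Longrightarrow> R u x2 \<Longrightarrow> distinct [v,u,x1,x2] \<Longrightarrow>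
    n - 3 \<le> card (G.N v - {x1, x2}) \<Longrightarrow> False"
  using free[of v u x1 x2] by (simp add: G.N_def)

text \<open>As for the other tree, but both continuations start at the same \<open>u\<close>. When
  both lie outside \<open>T\<close>, the vertex \<open>u\<close> is a common neighbour of
  \<open>x1\<close> and \<open>x2\<close> in \<open>T\<close>; it exists since
  \<open>2 * (n - 5) > n - 3\<close>.\<close>

lemma sparse_vertex:
  assumes S: "S \<subseteq> V" "card S = n"
  obtains r where "r \<in> S" "4 \<le> card (H.N r \<inter> S)"
proof (rule ccontr)
  note found = that
  assume no: "\<not> thesis"
  have low: "card (H.N r \<inter> S) \<le> 3" if "r \<in> S" for r
  proof -
    have "\<not> 4 \<le> card (H.N r \<inter> S)" using no found[OF that] by blast
    then show ?thesis by simp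
  qed
  obtain w where w: "w \<in> S" "n - 3 \<le> card (G.N w \<inter> S)" using not_regular[OF S low] by blast
  have finS: "finite S" using S(1) finV finite_subset by blast
  have deg: "n - 4 \<le> card (G.N r \<inter> S)" if "r \<in> S" for r
    using N_split[OF S(1) that] low[OF that] S(2) by linarith
  define T where "T = G.N w \<inter> S"
  define Q where "Q = S - insert w T"
  have wT: "w \<notin> T" using R_irr by (simp add: T_def)
  have cQ: "card Q = n - 1 - card T" "finite Q"
    using w(1) wT S(2) finS by (simp_all add: Q_def card_Diff_subset T_def)
  have finT: "finite T" by (simp add: T_def)
  have pick: "\<exists>x \<in> G.N r \<inter> S. x \<notin> K" if "r \<in> S" "card K \<le> 3" "finite K" for r K
    using ex_in_diff[of K "G.N r \<inter> S"] deg[OF that(1)] that(2,3) n9 by linarith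
  have TS: "T \<subseteq> S" "\<And>u. u \<in> T \<Longrightarrow> R w u" by (auto simp: T_def)
  have outer: "x \<in> T \<or> x \<in> Q" if "x \<in> S" "x \<noteq> w" for x using that by (auto simp: Q_def)
  have big: "card (T - {x,y}) \<le> card (G.N w - {x,y})" for x y
    by (intro card_mono) (auto simp: T_def)
  have Tle: "card T \<le> n - 1" using card_mono[of "S - {w}" T] wT TS finS w(1) S(2) by auto
  consider "card T = n - 3" | "card T = n - 2" | "card T = n - 1" using w(2) Tle by (fold T_def) linarith
  then show False
  proof cases
    case 1
    then have "2 \<le> card Q" using cQ n9 by simp
    then obtain x1 x2 where x: "x1 \<in> Q" "x2 \<in> Q" "x1 \<noteq> x2" by (rule ex_distinct2)
    have xS: "x1 \<in> S" "x2 \<in> S" "x1 \<noteq> w" "x2 \<noteq> w" "x1 \<notin> T" "x2 \<notin> T" using x by (auto simp: Q_def)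
    have Qc: "Q = {x1,x2}"
      using x cQ 1 n9 card_subset_eq[OF cQ(2), of "{x1,x2}"] by simp
    have many: "n - 5 \<le> card (G.N y \<inter> T)" if y: "y = x1 \<and> z = x2 \<or> y = x2 \<and> z = x1" for y z
    proof -
      have yS: "y \<in> S" "y \<notin> T" "y \<noteq> w" using y xS by auto
      then have "\<not> R y w" by (auto simp: T_def G.E_comm)
      have "G.N y \<inter> S \<subseteq> insert z (G.N y \<inter> T)"
      proof
        fix x assume x: "x \<in> G.N y \<inter> S"
        then have "x \<noteq> w" "x \<noteq> y" using \<open>\<not> R y w\<close> R_irr by auto
        then show "x \<in> insert z (G.N y \<inter> T)" using outer[of x] x y Qc by auto
      qed
      then have "card (G.N y \<inter> S) \<le> card (insert z (G.N y \<inter> T))" by (intro card_mono) auto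
      also have "\<dots> \<le> Suc (card (G.N y \<inter> T))" by (rule card_insert_le_m1) simp_all
      finally show ?thesis using deg[OF yS(1)] by linarith
    qed
    have "card (G.N x1 \<inter> T) + card (G.N x2 \<inter> T) \<le> card ((G.N x1 \<inter> T) \<inter> (G.N x2 \<inter> T)) + card T"
      by (rule card_Int_ge[OF finT]) auto
    then have "(G.N x1 \<inter> T) \<inter> (G.N x2 \<inter> T) \<noteq> {}"
      using many[of x1 x2] many[of x2 x1] 1 n9 by (intro notI) simp
    then obtain u where u: "R x1 u" "R x2 u" "u \<in> T" by auto
    moreover have "T - {x1,x2} = T" using xS by auto
    moreover have "u \<noteq> w" "u \<noteq> x1" "u \<noteq> x2" using u wT xS by auto
    ultimately show False
      using free'[of w u x1 x2] xS x(3) TS(2)[OF u(3)] big[of x1 x2] 1 R_sym[of x1 u] R_sym[of x2 u] by auto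
  next
    case 2
    then have "card Q = 1" using cQ n9 by simp
    then obtain x1 where Qc: "Q = {x1}" by (auto simp: card_1_singleton_iff)
    then have xS: "x1 \<in> S" "x1 \<noteq> w" "x1 \<notin> T" by (auto simp: Q_def)
    then have "\<not> R x1 w" by (auto simp: T_def G.E_comm)
    obtain u where u: "u \<in> G.N x1 \<inter> S" using pick[OF xS(1), of "{}"] by auto
    have u': "u \<noteq> w" "u \<noteq> x1" using u \<open>\<not> R x1 w\<close> R_irr by auto
    then have uT: "u \<in> T" using outer[of u] u Qc by auto
    have "u \<in> S" using u by auto
    obtain x2 where x2: "x2 \<in> G.N u \<inter> S" "x2 \<notin> {w,x1,x1}"
      using pick[OF \<open>u \<in> S\<close> card_le_3[of w x1 x1]] by auto
    have "x2 \<noteq> u" using x2 R_irr by auto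
    have "x2 \<in> T" using outer[of x2] x2 Qc by auto
    have "T - {x1, x2} = T - {x2}" using xS by auto
    then have "card (T - {x1,x2}) = n - 3" using \<open>x2 \<in> T\<close> 2 finT by simp
    then show False
      using free'[of w u x1 x2] u u' x2 xS TS(2)[OF uT] big[of x1 x2] \<open>x2 \<noteq> u\<close> R_sym[of x1 u] by auto
  next
    case 3
    then have "T \<noteq> {}" using n9 by auto
    then obtain u where u: "u \<in> T" by blast
    have uS: "u \<in> S" using u TS by auto
    obtain x1 where x1: "x1 \<in> G.N u \<inter> S" "x1 \<notin> {w, w, w}" using pick[OF uS card_le_3[of w w w]] by auto
    obtain x2 where x2: "x2 \<in> G.N u \<inter> S" "x2 \<notin> {w, x1, x1}" using pick[OF uS card_le_3[of w x1 x1]] by auto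
    have "x1 \<noteq> u" "x2 \<noteq> u" using x1 x2 R_irr by auto
    moreover have "n - 3 \<le> card (T - {x1,x2})" using card_Diff2_ge[OF finT, of x1 x2] 3 by simp
    ultimately show False
      using free'[of w u x1 x2] u x1 x2 TS(2)[OF u] big[of x1 x2] wT by auto
  qed
qed

text \<open>The rim of the wheel: four vertices \<open>w\<^sub>i\<close> joined by the common neighbour \<open>v\<close> and three
  vertices of \<open>U\<close>. It exists because every \<open>u\<close> misses at most one \<open>w\<^sub>i\<close> and no \<open>w\<^sub>i\<close> is missed
  by more than two \<open>u\<close>.\<close>

lemma almost_complete:
  assumes P: "card P = 4" "P \<subseteq> H.N r"
    and v: "E r v" "\<And>w. w \<in> P \<Longrightarrow> E v w"
    and U: "U \<subseteq> H.N r" "v \<notin> U" "U \<inter> P = {}" "4 \<le> card U"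
    and one: "\<And>u w w'. u \<in> U \<Longrightarrow> w \<in> P \<Longrightarrow> w' \<in> P \<Longrightarrow> R u w \<Longrightarrow> R u w' \<Longrightarrow> w = w'"
    and two: "\<And>w. w \<in> P \<Longrightarrow> card {u \<in> U. R u w} \<le> 2"
  shows False
proof -
  have V: "U \<subseteq> V" "P \<subseteq> V" using U(1) P(2) H.N_V by blast+
  have finU: "finite U" and finP: "finite P" using V finV finite_subset by blast+
  have E_iff: "E u w" if "u \<in> U" "w \<in> P" "\<not> R u w" for u w
    using that V U(3) by (auto simp: co_rel_def)
  have rim: False
    if d: "distinct [a,b,c,d]" "a \<in> P" "b \<in> P" "c \<in> P" "d \<in> P"
      and xyz: "distinct [x,y,z]" "x \<in> U" "y \<in> U" "z \<in> U"
      and n: "\<not> R x a" "\<not> R x b" "\<not> R y b" "\<not> R y c" "\<not> R z c" "\<not> R z d" for a b c d x y z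
  proof -
    have nu: "s \<noteq> t" if "s \<in> U" "t \<in> P" for s t using that U(3) by blast
    have nv: "v \<noteq> s" if "s \<in> P \<or> s \<in> U" for s using v(2) U(2) that H.irr by blast
    have "distinct [a,x,b,y,c,z,d,v]"
      using d xyz nv nu by auto
    moreover have "set [a,x,b,y,c,z,d,v] \<subseteq> H.N r"
      using subsetD[OF P(2)] d(2-) subsetD[OF U(1)] xyz(2-) v(1) by simp
    moreover have "successively E [a,x,b,y,c,z,d,v]" "E (last [a,x,b,y,c,z,d,v]) (hd [a,x,b,y,c,z,d,v])"
      using H.sym[OF E_iff[OF xyz(2) d(2) n(1)]] E_iff[OF xyz(2) d(3) n(2)]
        H.sym[OF E_iff[OF xyz(3) d(3) n(3)]] E_iff[OF xyz(3) d(4) n(4)]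
        H.sym[OF E_iff[OF xyz(4) d(4) n(5)]] E_iff[OF xyz(4) d(5) n(6)]
        H.sym[OF v(2)[OF d(5)]] v(2)[OF d(2)] by simp_all
    ultimately have "has_c8 E (H.N r)" unfolding has_c8_def
      by (intro exI[of _ "[a,x,b,y,c,z,d,v]"]) simp
    then show False using no_wheel by (simp add: H.N_def)
  qed
  show False
  proof (cases "\<exists>a\<in>P. 2 \<le> card {u \<in> U. R u a}")
    case True
    \<comment> \<open>\<open>y\<close> and \<open>z\<close> miss only \<open>a\<close>, so they fit
      between any two of the other vertices of \<open>P\<close>. Only \<open>x\<close>, which does
      not miss \<open>a\<close>, goes next to \<open>a\<close>, with a second neighbour
      \<open>b\<close> that it does not miss either.\<close>
    then obtain a where a: "a \<in> P" "2 \<le> card {u \<in> U. R u a}" by blast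
    from a(2) obtain y z where yz: "y \<in> U" "R y a" "z \<in> U" "R z a" "y \<noteq> z"
      using ex_distinct2[of "{u \<in> U. R u a}"] by blast
    have "card {u \<in> U. R u a} < card U" using two[OF a(1)] U(4) by simp
    then obtain x where x: "x \<in> U" "\<not> R x a" using ex_in_diff[of "{u \<in> U. R u a}" U] finU by auto
    have xyz: "distinct [x,y,z]" using x yz by auto
    have "3 \<le> card (P - {a})" using P(1) a(1) finP by simp
    then obtain b0 c0 d where bc: "b0 \<in> P - {a}" "c0 \<in> P - {a}" "d \<in> P - {a}" "distinct [b0,c0,d]"
      by (rule ex_distinct3)
    have "\<not> R x b0 \<or> \<not> R x c0" using one[OF x(1), of b0 c0] bc by auto
    then obtain b c where b: "(b, c) = (b0, c0) \<or> (b, c) = (c0, b0)" "\<not> R x b" by blast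
    have bP: "b \<in> P" "c \<in> P" "d \<in> P" "distinct [a,b,c,d]" using bc b(1) by auto
    have n: "\<not> R y b" "\<not> R y c" "\<not> R z c" "\<not> R z d"
      using one[OF yz(1) a(1) bP(1) yz(2)] one[OF yz(1) a(1) bP(2) yz(2)]
        one[OF yz(3) a(1) bP(2) yz(4)] one[OF yz(3) a(1) bP(3) yz(4)] bP(4) by auto
    show False by (rule rim[OF bP(4) a(1) bP(1-3) xyz x(1) yz(1,3) x(2) b(2) n])
  next
    case False
    have "3 \<le> card U" using U(4) by simp
    then obtain x y z where U3: "x \<in> U" "y \<in> U" "z \<in> U" and xyz: "distinct [x,y,z]"
      by (rule ex_distinct3)
    have single: "s = t" if "a \<in> P" "s \<in> U" "t \<in> U" "R s a" "R t a" for a s t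
    proof (rule ccontr)
      assume "s \<noteq> t"
      then have "card {s, t} \<le> card {u \<in> U. R u a}" using that finU by (intro card_mono) auto
      then show False using False that(1) \<open>s \<noteq> t\<close> by auto
    qed
    \<comment> \<open>The sets missed by \<open>x\<close>, \<open>y\<close>, \<open>z\<close> are
      disjoint and have at most one element each. Their elements, or arbitrary vertices where a set
      is empty, are named \<open>d\<close>, \<open>a\<close>, \<open>b\<close>, so that
      \<open>x\<close> fits between \<open>a\<close> and \<open>b\<close>, \<open>y\<close> between
      \<open>b\<close> and \<open>c\<close>, and \<open>z\<close> between \<open>c\<close> and
      \<open>d\<close>.\<close>
    define M where "M u = {w \<in> P. R u w}" for u
    have choose: "\<exists>w \<in> P. M u \<subseteq> {w} \<and> w \<notin> K"
      if u: "u \<in> U" and K: "M u \<inter> K = {}" "card K \<le> 3" "finite K" for u K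
    proof (cases "M u = {}")
      case True
      then show ?thesis using ex_in_diff[of K P] K(2,3) P(1) by auto
    next
      case False
      then obtain w where w: "w \<in> M u" by blast
      then have "M u \<subseteq> {w}" using one[OF u] by (auto simp: M_def)
      then show ?thesis using w K(1) by (auto simp: M_def)
    qed
    have M1: "card (M u) \<le> 1" if u: "u \<in> U" for u
    proof -
      from choose[OF u, of "{}"] obtain w where "M u \<subseteq> {w}" by auto
      then show ?thesis using card_mono[of "{w}" "M u"] by simp
    qed
    have dj: "M x \<inter> M y = {}" "M x \<inter> M z = {}" "M y \<inter> M z = {}"
      using single[OF _ U3(1,2)] single[OF _ U3(1,3)] single[OF _ U3(2,3)] xyz by (auto simp: M_def)
    have finM: "finite (M u)" for u using finP by (simp add: M_def)
    have "card (M y \<union> M z) \<le> 3" using card_Un_le[of "M y" "M z"] M1[OF U3(2)] M1[OF U3(3)] by linarith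
    moreover have "M x \<inter> (M y \<union> M z) = {}" using dj by blast
    ultimately obtain d where d: "d \<in> P" "M x \<subseteq> {d}" "d \<notin> M y" "d \<notin> M z"
      using choose[OF U3(1), of "M y \<union> M z"] finM by auto
    have "card (insert d (M z)) \<le> 3"
      using card_insert_le_m1[of 3 "M z" d] M1[OF U3(3)] by simp
    moreover have "M y \<inter> insert d (M z) = {}" using dj d by blast
    ultimately obtain a where a: "a \<in> P" "M y \<subseteq> {a}" "a \<noteq> d" "a \<notin> M z"
      using choose[OF U3(2), of "insert d (M z)"] finM by auto
    have "M z \<inter> {a,d,d} = {}" using d a by blast
    then obtain b where b: "b \<in> P" "M z \<subseteq> {b}" "b \<noteq> a" "b \<noteq> d"
      using choose[OF U3(3) _ card_le_3[of a d d]] by auto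
    have "card {a,b,d} < card P" using P(1) card_le_3[of a b d] by simp
    then obtain c where c: "c \<in> P" "c \<notin> {a,b,d}" using ex_in_diff[of "{a,b,d}" P] by auto
    have mx: "s = d" if "R x s" "s \<in> P" for s using d(2) that by (auto simp: M_def)
    have my: "s = a" if "R y s" "s \<in> P" for s using a(2) that by (auto simp: M_def)
    have mz: "s = b" if "R z s" "s \<in> P" for s using b(2) that by (auto simp: M_def)
    show False
    proof (rule rim[OF _ a(1) b(1) c(1) d(1) xyz U3])
      show "distinct [a,b,c,d]" using a b c by auto
      show "\<not> R x a" "\<not> R x b" using mx a b by auto
      show "\<not> R y b" "\<not> R y c" using my b c by auto
      show "\<not> R z c" "\<not> R z d" using mz b c d by auto
    qed
  qed
qed

text \<open>Excluding the tree limits each \<open>u\<close> in \<open>U\<close>: for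
  \<open>n - 1 \<le> card U\<close> it has at most one neighbour besides \<open>v\<close>; for
  \<open>n - 2\<close>, if it has a neighbour in \<open>W\<close>, it has no other besides
  \<open>v\<close>; for \<open>n - 3\<close> it has at most one neighbour in
  \<open>W\<close>.\<close>

lemma contradiction: False
proof -
  obtain v where v: "v \<in> V" "n - 3 \<le> card (G.N v)" by (rule large_degree)
  define U where "U = G.N v"
  define W where "W = V - insert v U"
  have UV: "U \<subseteq> V" "v \<notin> U" "finite U" using G.N_V R_irr by (auto simp: U_def)
  have cW: "card W = 2 * n - 2 - card U" using UV v cardV by (simp add: W_def card_Diff_subset)
  have WV: "W \<subseteq> V" "finite W" using finV by (auto simp: W_def)
  have WU: "W \<inter> U = {}" "v \<notin> W" by (auto simp: W_def)
  have free_v: False if "u \<in> U" "R u x1" "R u x2" "x1 \<noteq> x2" "x1 \<noteq> v" "x2 \<noteq> v"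
    "n - 3 \<le> card (U - {x1, x2})" for u x1 x2
    using free'[of v u x1 x2] that UV R_irr by (auto simp: U_def)
  have vW: "E v s" if "s \<in> W" for s using that v by (intro E_outside) (auto simp: W_def U_def)
  have E_UW: "E u s" if "u \<in> U" "s \<in> W" "\<not> R u s" for u s
    using that UV by (intro E_outside) (auto simp: W_def)
  have at_most_one: "card A \<le> 1" if "\<And>s t. s \<in> A \<Longrightarrow> t \<in> A \<Longrightarrow> s = t" for A :: "'a set"
    using that by (metis card.infinite card_le_Suc0_iff_eq One_nat_def zero_le)
  consider "n - 1 \<le> card U" | "card U = n - 2" | "card U = n - 3" using v(2) by (fold U_def) linarith
  then show False
  proof cases
    case 1
    have one: "card (G.N u - {v}) \<le> 1" if "u \<in> U" for u
    proof (rule at_most_one)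
      fix s t assume "s \<in> G.N u - {v}" "t \<in> G.N u - {v}"
      then show "s = t"
        using free_v[of u s t] that card_Diff2_ge[OF UV(3), of s t] 1 by fastforce
    qed
    obtain h where h: "h \<in> U" using 1 n9 by fastforce
    define U' where "U' = U - insert h (G.N h - {v})"
    have "card (insert h (G.N h - {v})) \<le> 2"
      using card_insert_le_m1[of 2 "G.N h - {v}" h] one[OF h] by simp
    then have "4 \<le> card U'"
      using diff_card_le_card_Diff[of "insert h (G.N h - {v})" U] 1 n9 by (simp add: U'_def)
    then obtain P where P: "P \<subseteq> U'" "card P = 4" "finite P" by (metis obtain_subset_with_card_n)
    have PU: "P \<subseteq> U" using P by (auto simp: U'_def)
    \<comment> \<open>These vertices cannot serve as the other half of a rim with hub
      \<open>h\<close> that uses \<open>P\<close>. There are at most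
      \<open>2 + 4 + 1 + 4 = 11\<close> of them.\<close>
    define K where "K = insert v (insert h (P \<union> (G.N h - {v}) \<union> (\<Union>p\<in>P. G.N p - {v})))"
    have finK: "finite K" using P by (simp add: K_def)
    have "card (\<Union>p\<in>P. G.N p - {v}) \<le> (\<Sum>p\<in>P. card (G.N p - {v}))"
      using P(3) by (rule card_UN_le)
    also have "\<dots> \<le> (\<Sum>p\<in>P. 1)" using one PU by (intro sum_mono) auto
    finally have c1: "card (\<Union>p\<in>P. G.N p - {v}) \<le> 4" using P by simp
    have "card (P \<union> (G.N h - {v}) \<union> (\<Union>p\<in>P. G.N p - {v})) \<le>
        card P + card (G.N h - {v}) + card (\<Union>p\<in>P. G.N p - {v})"
      by (meson add_le_mono1 card_Un_le order_trans)
    then have "card (P \<union> (G.N h - {v}) \<union> (\<Union>p\<in>P. G.N p - {v})) \<le> 9"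
      using c1 P one[OF h] by linarith
    then have "card (insert h (P \<union> (G.N h - {v}) \<union> (\<Union>p\<in>P. G.N p - {v}))) \<le> 10"
      using card_insert_le_m1[of 10] by simp
    then have "card K \<le> 11" unfolding K_def using card_insert_le_m1[of 11] by simp
    then have c4: "4 \<le> card (V - K)"
      using diff_card_le_card_Diff[OF finK, of V] cardV n9 by simp
    show False
    proof (rule complete_bipartite[OF _ _ _ c4])
      show "P \<subseteq> H.N h"
      proof
        fix p assume "p \<in> P"
        then have "p \<in> V" "p \<noteq> h" "p \<notin> G.N h" using P(1) UV by (auto simp: U'_def)
        then show "p \<in> H.N h" using E_outside[of h p] h UV by auto
      qed
      show "V - K \<subseteq> H.N h"
      proof
        fix s assume "s \<in> V - K"
        then have s: "s \<in> V" "s \<noteq> h" "s \<notin> G.N h" by (auto simp: K_def)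
        then show "s \<in> H.N h" using E_outside[of h s] h UV(1) by auto
      qed
      show "E p q" if "p \<in> P" "q \<in> V - K" for p q
        using that PU UV by (intro E_outside) (auto simp: K_def)
    qed (use P in simp)
  next
    case 2
    have cWn: "card W = n" using cW 2 n9 by simp
    define L where "L = {u \<in> U. \<exists>s\<in>W. R u s}"
    have L: "\<exists>s\<in>W. G.N u \<subseteq> {v, s}" if "u \<in> L" for u
    proof -
      from that obtain s where s: "s \<in> W" "R u s" "u \<in> U" by (auto simp: L_def)
      have "x \<in> {v, s}" if x: "R u x" for x
      proof (rule ccontr)
        assume "x \<notin> {v, s}"
        moreover have "U - {s, x} = U - {x}" using s WU by auto
        moreover have "card U - 1 \<le> card (U - {x})" using UV(3) by (simp add: card_Diff_singleton_if)
        ultimately show False using free_v[of u s x] s x WU 2 by auto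
      qed
      then have "G.N u \<subseteq> {v, s}" by (intro subsetI) (simp only: G.in_N)
      then show ?thesis using s(1) by blast
    qed
    have LU: "L \<subseteq> U" "finite L" using UV by (auto simp: L_def)
    show False
    \<comment> \<open>Five elements of \<open>L\<close> provide a hub and half of a rim, the other
      half being vertices of \<open>W\<close> that none of the five is adjacent to in
      \<open>G\<close>. With fewer, at least three vertices of \<open>U\<close> have no neighbour in
      \<open>W\<close>, and together with \<open>v\<close> they form \<open>Z\<close> in
      \<open>complete_to_set\<close>.\<close>
    proof (cases "5 \<le> card L")
      case True
      then obtain T where T: "T \<subseteq> L" "card T = 5" "finite T" by (metis obtain_subset_with_card_n)
      obtain h where h: "h \<in> T" using T(2) by fastforce
      obtain f where f: "f u \<in> W" "G.N u \<subseteq> {v, f u}" if "u \<in> L" for u using L by metis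
      have "card (f ` T) \<le> 5" using card_image_le[OF T(3), of f] T(2) by simp
      then have c4: "4 \<le> card (W - f ` T)"
        using diff_card_le_card_Diff[of "f ` T" W] T(3) cWn n9 by simp
      have far: "E u s" if us: "u \<in> T" "s \<in> W - f ` T" for u s
      proof (rule E_UW)
        show "u \<in> U" "s \<in> W" using us T(1) LU(1) by auto
        have "s \<noteq> v" "s \<noteq> f u" using us WU(2) by auto
        moreover have "G.N u \<subseteq> {v, f u}" using f(2) us(1) T(1) by blast
        ultimately show "\<not> R u s" by auto
      qed
      show False
      proof (rule complete_bipartite[OF _ _ _ c4])
        show "T - {h} \<subseteq> H.N h"
        proof
          fix p assume p: "p \<in> T - {h}"
          have "p \<in> U" "h \<in> L" "h \<in> U" using p h T(1) LU by auto
          then have "p \<notin> G.N h" using f[of h] UV(2) WU by auto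
          then show "p \<in> H.N h" using E_outside[of h p] p UV \<open>p \<in> U\<close> \<open>h \<in> U\<close> by auto
        qed
        show "W - f ` T \<subseteq> H.N h" using far[OF h] by auto
        show "4 \<le> card (T - {h})" using T h by simp
        show "E p q" if "p \<in> T - {h}" "q \<in> W - f ` T" for p q using far that by auto
      qed
    next
      case False
      obtain r where r: "r \<in> W" "4 \<le> card (H.N r \<inter> W)" using sparse_vertex[OF WV(1) cWn] by blast
      have "card (insert v (U - L)) = Suc (card U - card L)"
        using UV LU by (simp add: card_Diff_subset)
      then have c4: "4 \<le> card (insert v (U - L))" using 2 n9 False by simp
      have "E z s" if "z \<in> insert v (U - L)" "s \<in> W" for z s
        using that vW E_UW by (auto simp: L_def)
      then show False by (rule complete_to_set[OF WV(1) r c4])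
    qed
  next
    case 3
    have cW1: "card W = n + 1" using cW 3 n9 by simp
    have one: "s = t" if "u \<in> U" "s \<in> W" "t \<in> W" "R u s" "R u t" for u s t
    proof (rule ccontr)
      assume "s \<noteq> t"
      moreover have "U - {s, t} = U" using that WU by auto
      ultimately show False using free_v[of u s t] that WU 3 by auto
    qed
    define f where "f s = card {u \<in> U. R u s}" for s
    have "W \<noteq> {}" using cW1 by auto
    \<comment> \<open>A vertex of \<open>W\<close> with most neighbours in \<open>U\<close> is
      deleted. If it has three, these have no other neighbour in \<open>W\<close> and form
      \<open>Z\<close> together with \<open>v\<close>; if not, every vertex of \<open>W\<close> has
      at most two, as \<open>almost_complete\<close> requires.\<close>
    then obtain y where y: "y \<in> W" "\<And>s. s \<in> W \<Longrightarrow> f s \<le> f y"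
    proof -
      have "finite (f ` W)" "f ` W \<noteq> {}" using WV(2) \<open>W \<noteq> {}\<close> by auto
      from Max_in[OF this] obtain y where "y \<in> W" "f y = Max (f ` W)" by auto
      then show thesis using that Max_ge[OF \<open>finite (f ` W)\<close>] by simp
    qed
    have WV': "W - {y} \<subseteq> V" using WV by auto
    have "card (W - {y}) = n" using cW1 y(1) WV(2) by simp
    then obtain r where r: "r \<in> W - {y}" "4 \<le> card (H.N r \<inter> (W - {y}))"
      using sparse_vertex[OF WV'] by blast
    show False
    proof (cases "3 \<le> f y")
      case True
      let ?Z = "insert v {u \<in> U. R u y}"
      have "card ?Z = Suc (f y)" using UV by (simp add: f_def)
      then have c4: "4 \<le> card ?Z" using True by simp
      have "E z s" if z: "z \<in> ?Z" "s \<in> W - {y}" for z s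
        using z vW[of s] E_UW[of z s] one[of z s y] y(1) by auto
      then show False by (rule complete_to_set[OF WV' r c4])
    next
      case False
      then have f2: "f s \<le> 2" if "s \<in> W" for s using y(2)[OF that] by simp
      obtain P where P: "P \<subseteq> H.N r \<inter> (W - {y})" "card P = 4"
        by (metis obtain_subset_with_card_n r(2))
      then have w: "card P = 4" "P \<subseteq> H.N r" "P \<subseteq> W" by auto
      define U' where "U' = U - {u \<in> U. R u r}"
      have rW: "r \<in> W" using r(1) by simp
      have "card U' = card U - f r" using UV by (simp add: U'_def f_def card_Diff_subset)
      then have c4: "4 \<le> card U'" using 3 f2[OF rW] n9 by simp
      show False
      proof (rule almost_complete[OF w(1,2) _ _ _ _ _ c4])
        show "E r v" using vW[OF rW] by (rule H.sym)
        show "E v s" if "s \<in> P" for s using vW that w(3) by blast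
        show "U' \<subseteq> H.N r"
        proof
          fix u assume "u \<in> U'"
          then have "u \<in> U" "\<not> R u r" by (auto simp: U'_def)
          from H.sym[OF E_UW[OF this(1) rW this(2)]] show "u \<in> H.N r" by simp
        qed
        show "v \<notin> U'" "U' \<inter> P = {}" using UV(2) w(3) WU by (auto simp: U'_def)
        show "s = t" if "u \<in> U'" "s \<in> P" "t \<in> P" "R u s" "R u t" for u s t
          using one[of u s t] that w(3) by (auto simp: U'_def)
        show "card {u \<in> U'. R u s} \<le> 2" if "s \<in> P" for s
        proof -
          have "card {u \<in> U'. R u s} \<le> f s" unfolding f_def
            using UV(3) by (intro card_mono) (auto simp: U'_def)
          moreover have "s \<in> W" using that w(3) by blast
          ultimately show ?thesis using f2[of s] by simp
        qed
      qed
    qed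
  qed
qed

end

section \<open>Copies and Ramsey numbers\<close>

lemma pair_graph_iff:
  "pair_graph F \<longleftrightarrow> finite (pverts F) \<and> (\<forall>u v. (u, v) \<in> parcs F \<longrightarrow>
     u \<in> pverts F \<and> u \<noteq> v \<and> (v, u) \<in> parcs F)"
proof
  assume "pair_graph F"
  then interpret pair_graph F .
  show "finite (pverts F) \<and> (\<forall>u v. (u, v) \<in> parcs F \<longrightarrow>
     u \<in> pverts F \<and> u \<noteq> v \<and> (v, u) \<in> parcs F)"
    using pair_finite_verts in_arcsD1 no_loops' arcs_symmetric by blast
next
  assume F: "finite (pverts F) \<and> (\<forall>u v. (u, v) \<in> parcs F \<longrightarrow>
     u \<in> pverts F \<and> u \<noteq> v \<and> (v, u) \<in> parcs F)"
  then have sub: "parcs F \<subseteq> pverts F \<times> pverts F" by auto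
  then have "finite (parcs F)" using F by (meson finite_SigmaI finite_subset)
  then show "pair_graph F"
    using F sub by unfold_locales (force simp: symmetric_def sym_def)+
qed

text \<open>The copy is the image of \<open>G\<close> under \<open>f\<close>. With
  \<open>contains_copyE\<close>, containment reduces to the existence of an injective
  homomorphism.\<close>

lemma contains_copyI:
  assumes F: "pair_graph F" and G: "pair_graph G"
    and f: "inj_on f (pverts G)" "f ` pverts G \<subseteq> pverts F"
    and e: "\<And>u v. (u, v) \<in> parcs G \<Longrightarrow> (f u, f v) \<in> parcs F"
  shows "contains_copy F G"
proof -
  let ?K = "\<lparr> pverts = f ` pverts G, parcs = map_prod f f ` parcs G \<rparr>"
  have G': "u \<in> pverts G" "v \<in> pverts G" "u \<noteq> v" "(v, u) \<in> parcs G" if "(u, v) \<in> parcs G" for u v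
    using G that unfolding pair_graph_iff by blast+
  have "f u \<noteq> f v" if "(u, v) \<in> parcs G" for u v
    using inj_onD[OF f(1)] G'[OF that] by blast
  moreover have "(f v, f u) \<in> map_prod f f ` parcs G" if "(u, v) \<in> parcs G" for u v
    using G'(4)[OF that] by (metis map_prod_imageI)
  ultimately have K: "pair_graph ?K"
    unfolding pair_graph_iff using G G'(1) by (auto simp: pair_graph_iff)
  have wf: "wf_digraph (with_proj G)" "wf_digraph (with_proj F)" "wf_digraph (with_proj ?K)"
    using F G K by (simp_all add: wf_digraph_wp_iff pair_graph_def pair_digraph_def pair_fin_digraph_def)
  have "subgraph (with_proj ?K) (with_proj F)"
    using wf f(2) e by (auto simp: subgraph_def compatible_def)
  moreover have "digraph_iso (with_proj G) (with_proj ?K)"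
  proof -
    let ?h = "\<lparr> iso_verts = f, iso_arcs = map_prod f f, iso_head = snd, iso_tail = fst \<rparr>"
    have "inj_on (map_prod f f) (parcs G)"
      using f(1) G' by (auto simp: inj_on_def)
    then have "pre_digraph.digraph_isomorphism (with_proj G) ?h"
      unfolding pre_digraph.digraph_isomorphism_def using wf f(1) by auto
    moreover have "with_proj ?K = app_iso ?h (with_proj G)"
      by (simp add: app_iso_def with_proj_def)
    ultimately show ?thesis unfolding digraph_iso_def by blast
  qed
  ultimately show ?thesis unfolding contains_copy_def using K by blast
qed

lemma contains_copyE:
  assumes "contains_copy F G"
  obtains f where "inj_on f (pverts G)" "f ` pverts G \<subseteq> pverts F"
    "\<forall>u v. (u, v) \<in> parcs G \<longrightarrow> (f u, f v) \<in> parcs F"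
proof -
  obtain K where K: "pair_graph K" "subgraph (with_proj K) (with_proj F)"
    "digraph_iso (with_proj G) (with_proj K)"
    using assms unfolding contains_copy_def by blast
  then obtain h where h: "pre_digraph.digraph_isomorphism (with_proj G) h"
    "with_proj K = app_iso h (with_proj G)"
    unfolding digraph_iso_def by blast
  have vK: "pverts K = iso_verts h ` pverts G" and aK: "parcs K = iso_arcs h ` parcs G"
    and t: "iso_tail h = fst" "iso_head h = snd"
    using arg_cong[OF h(2), of verts] arg_cong[OF h(2), of arcs]
      arg_cong[OF h(2), of tail] arg_cong[OF h(2), of head] by simp_all
  have sub: "pverts K \<subseteq> pverts F" "parcs K \<subseteq> parcs F"
    using K(2) by (auto simp: subgraph_def)
  show thesis
  proof (rule that[of "iso_verts h"])
    show "inj_on (iso_verts h) (pverts G)"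
      using h(1) unfolding pre_digraph.digraph_isomorphism_def by simp
    show "iso_verts h ` pverts G \<subseteq> pverts F" using vK sub by simp
    have "(iso_verts h u, iso_verts h v) \<in> parcs F" if uv: "(u, v) \<in> parcs G" for u v
    proof -
      have "iso_arcs h (u, v) \<in> parcs F" using uv aK sub by blast
      moreover have "iso_verts h u = fst (iso_arcs h (u, v)) \<and> iso_verts h v = snd (iso_arcs h (u, v))"
        using h(1) uv unfolding pre_digraph.digraph_isomorphism_def t by force
      ultimately show ?thesis by simp
    qed
    then show "\<forall>u v. (u, v) \<in> parcs G \<longrightarrow> (iso_verts h u, iso_verts h v) \<in> parcs F" by blast
  qed
qed

lemma pair_graph_complement: "pair_graph F \<Longrightarrow> pair_graph (complement_graph F)"
  unfolding pair_graph_iff complement_graph_def by auto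

section \<open>The trees and the wheel in explicit form\<close>

lemma S_two_one_simps:
  assumes "5 \<le> n"
  shows "pverts (S_two_one n) = {..<n}"
    and "(i, j) \<in> parcs (S_two_one n) \<longleftrightarrow>
      (let e = (\<lambda>i j. i = 0 \<and> 3 \<le> j \<and> j < n \<or> i = 1 \<and> j = n - 2 \<or> i = 2 \<and> j = n - 1)
       in e i j \<or> e j i)"
proof -
  show "pverts (S_two_one n) = {..<n}"
    using assms unfolding S_two_one_def star_graph_def star_on_def subdivide.simps by auto
  show "(i, j) \<in> parcs (S_two_one n) \<longleftrightarrow>
      (let e = (\<lambda>i j. i = 0 \<and> 3 \<le> j \<and> j < n \<or> i = 1 \<and> j = n - 2 \<or> i = 2 \<and> j = n - 1)
       in e i j \<or> e j i)"
    using assms unfolding S_two_one_def star_graph_def star_on_def subdivide.simps Let_def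
    apply (simp del: One_nat_def)
    apply (cases "i = 0"; cases "j = 0"; simp)
    by arith+
qed

lemma S_three_simps:
  assumes "4 \<le> n"
  shows "pverts (S_three n) = {..<n}"
    and "(i, j) \<in> parcs (S_three n) \<longleftrightarrow>
      (let e = (\<lambda>i j. i = 0 \<and> 1 \<le> j \<and> j \<le> n - 3 \<or> i = n - 3 \<and> (j = n - 2 \<or> j = n - 1))
       in e i j \<or> e j i)"
proof -
  show "pverts (S_three n) = {..<n}"
    using assms unfolding S_three_def star_graph_def star_on_def join_by_edge_def by auto
  show "(i, j) \<in> parcs (S_three n) \<longleftrightarrow>
      (let e = (\<lambda>i j. i = 0 \<and> 1 \<le> j \<and> j \<le> n - 3 \<or> i = n - 3 \<and> (j = n - 2 \<or> j = n - 1))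
       in e i j \<or> e j i)"
    using assms unfolding S_three_def star_graph_def star_on_def join_by_edge_def Let_def
    apply (simp del: One_nat_def)
    apply (cases "i = 0"; cases "j = 0"; simp)
    by arith+
qed

lemma wheel_graph_simps:
  "pverts (wheel_graph 8) = {..<9}"
  "(i, j) \<in> parcs (wheel_graph 8) \<longleftrightarrow> i < 8 \<and> j < 8 \<and> (j = (i + 1) mod 8 \<or> i = (j + 1) mod 8)
     \<or> i = 8 \<and> j < 8 \<or> j = 8 \<and> i < 8"
proof -
  show "pverts (wheel_graph 8) = {..<9}"
    unfolding wheel_graph_def cycle_graph_def star_on_def by auto
  show "(i, j) \<in> parcs (wheel_graph 8) \<longleftrightarrow> i < 8 \<and> j < 8 \<and> (j = (i + 1) mod 8 \<or> i = (j + 1) mod 8)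
     \<or> i = 8 \<and> j < 8 \<or> j = 8 \<and> i < 8"
    unfolding wheel_graph_def cycle_graph_def star_on_def by simp blast
qed

lemma pair_graph_wheel: "pair_graph (wheel_graph 8)"
proof -
  have "i \<noteq> Suc i mod 8" "Suc i mod 8 \<noteq> i" for i :: nat by presburger+
  then show ?thesis unfolding pair_graph_iff wheel_graph_simps by auto
qed

lemma pair_graph_S_two_one: "5 \<le> n \<Longrightarrow> pair_graph (S_two_one n)"
  unfolding pair_graph_iff by (simp add: S_two_one_simps Let_def) auto

lemma pair_graph_S_three: "4 \<le> n \<Longrightarrow> pair_graph (S_three n)"
  unfolding pair_graph_iff by (simp add: S_three_simps Let_def) auto

lemma contains_wheel:
  assumes F: "pair_graph F" and c: "has_c8 (\<lambda>x y. (x, y) \<in> parcs F) {y. (h, y) \<in> parcs F}"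
  shows "contains_copy F (wheel_graph 8)"
proof -
  obtain zs where zs: "length zs = 8" "distinct zs" "set zs \<subseteq> {y. (h, y) \<in> parcs F}"
    "successively (\<lambda>x y. (x, y) \<in> parcs F) zs" "(last zs, hd zs) \<in> parcs F"
    using c unfolding has_c8_def by blast
  have F': "u \<in> pverts F" "v \<in> pverts F" "u \<noteq> v" "(v, u) \<in> parcs F" if "(u, v) \<in> parcs F" for u v
    using F that unfolding pair_graph_iff by blast+
  \<comment> \<open>The index 8 is the hub of \<open>wheel_graph 8\<close>.\<close>
  define f where "f i = (if i < 8 then zs ! i else h)" for i :: nat
  have in_h: "(h, zs ! i) \<in> parcs F" if "i < 8" for i
  proof -
    have "zs ! i \<in> set zs" using zs(1) that by simp
    then show ?thesis using zs(3) by blast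
  qed
  have ne: "h \<noteq> zs ! i" if "i < 8" for i using F'(3)[OF in_h[OF that]] .
  have step: "(zs ! i, zs ! ((i + 1) mod 8)) \<in> parcs F" if "i < 8" for i
  proof (cases "i = 7")
    case True
    have "zs \<noteq> []" using zs(1) by auto
    then show ?thesis using zs(1,5) True by (simp add: last_conv_nth hd_conv_nth)
  next
    case False
    then show ?thesis using zs(1,4) that by (simp add: successively_conv_nth)
  qed
  show ?thesis
  proof (rule contains_copyI[OF F pair_graph_wheel, of f])
    show "inj_on f (pverts (wheel_graph 8))"
    proof (rule inj_onI)
      fix i j assume "i \<in> pverts (wheel_graph 8)" "j \<in> pverts (wheel_graph 8)" "f i = f j"
      then show "i = j"
        using ne[of i] ne[of j] nth_eq_iff_index_eq[OF zs(2), of i j] zs(1)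
        by (auto simp: f_def wheel_graph_simps split: if_splits)
    qed
    show "f ` pverts (wheel_graph 8) \<subseteq> pverts F"
      using F'(1,2)[OF in_h] F'(1)[OF in_h[of 0]] by (auto simp: f_def)
    have e: "(f u, f v) \<in> parcs F" if "u < 8 \<and> v < 8 \<and> v = (u + 1) mod 8 \<or> u = 8 \<and> v < 8" for u v
      using that
    proof
      assume "u < 8 \<and> v < 8 \<and> v = (u + 1) mod 8"
      then show ?thesis using step[of u] by (simp add: f_def)
    next
      assume "u = 8 \<and> v < 8"
      then show ?thesis using in_h[of v] by (simp add: f_def)
    qed
    show "(f u, f v) \<in> parcs F" if "(u, v) \<in> parcs (wheel_graph 8)" for u v
      using that e[of u v] F'(4)[OF e[of v u]] unfolding wheel_graph_simps by blast
  qed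
qed

text \<open>In \<open>S_two_one n\<close> the neighbours of the centre \<open>0\<close> are the vertices \<open>i \<ge> 3\<close>, so \<open>x1\<close>, \<open>x2\<close>,
  \<open>u1\<close>, \<open>u2\<close> play the roles of \<open>1\<close>, \<open>2\<close>, \<open>n - 2\<close>, \<open>n - 1\<close>.\<close>

lemma contains_S_two_one:
  assumes F: "pair_graph F" and n: "5 \<le> n"
    and R: "(v, u1) \<in> parcs F" "(v, u2) \<in> parcs F" "(u1, x1) \<in> parcs F" "(u2, x2) \<in> parcs F"
    and d: "distinct [v,u1,u2,x1,x2]" and c: "n - 3 \<le> card ({y. (v, y) \<in> parcs F} - {x1, x2})"
  shows "contains_copy F (S_two_one n)"
proof -
  have F': "u \<in> pverts F" "v \<in> pverts F" "u \<noteq> v" "(v, u) \<in> parcs F" if "(u, v) \<in> parcs F" for u v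
    using F that unfolding pair_graph_iff by blast+
  let ?A = "{y. (v, y) \<in> parcs F} - {x1, x2}"
  have "?A \<subseteq> pverts F" using F' by auto
  moreover have "finite (pverts F)" using F by (simp add: pair_graph_iff)
  ultimately have finA: "finite ?A" by (rule finite_subset)
  have "card (?A - {u1, u2}) = card ?A - 2" using R d finA by (simp add: card_Diff_subset)
  then have "n - 5 \<le> card (?A - {u1, u2})" using c by linarith
  then obtain zs where zs: "length zs = n - 5" "distinct zs" "set zs \<subseteq> ?A - {u1, u2}"
    using ex_distinct_list by blast
  define us where "us = [v, x1, x2] @ zs @ [u1, u2]"
  have len: "length us = n" using n zs by (simp add: us_def)
  have dist: "distinct us"
    using d zs F'(3) by (auto simp: us_def)
  have nb: "(v, us ! i) \<in> parcs F" if "3 \<le> i" "i < n" for i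
  proof -
    have "us ! i = (zs @ [u1, u2]) ! (i - 3)" using that nth_append[of "[v,x1,x2]" "zs @ [u1,u2]" i] by (simp add: us_def numeral_3_eq_3)
    moreover have "i - 3 < length (zs @ [u1, u2])" using that zs n by simp
    ultimately have "us ! i \<in> set (zs @ [u1, u2])" by (metis nth_mem)
    then show ?thesis using zs(3) R by auto
  qed
  have at: "us ! 0 = v" "us ! 1 = x1" "us ! 2 = x2" "us ! (n - 2) = u1" "us ! (n - 1) = u2"
  proof -
    show "us ! 0 = v" "us ! 1 = x1" "us ! 2 = x2" by (simp_all add: us_def)
    have l: "n - 2 = length ([v,x1,x2] @ zs)" "n - 1 = length ([v,x1,x2] @ zs) + 1"
      using n zs(1) by simp_all
    have us: "us = ([v,x1,x2] @ zs) @ [u1,u2]" by (simp add: us_def)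
    show "us ! (n - 2) = u1" "us ! (n - 1) = u2"
      unfolding us l nth_append_length nth_append_length_plus by simp_all
  qed
  show ?thesis
  proof (rule contains_copyI[OF F pair_graph_S_two_one[OF n], of "\<lambda>i. us ! i"])
    show "inj_on ((!) us) (pverts (S_two_one n))"
      using dist len n by (simp add: S_two_one_simps inj_on_nth)
    have "set us \<subseteq> pverts F" using zs(3) R F' d by (auto simp: us_def)
    then show "(!) us ` pverts (S_two_one n) \<subseteq> pverts F"
      using len n by (auto simp: S_two_one_simps)
    have e: "(us ! i, us ! j) \<in> parcs F"
      if "i = 0 \<and> 3 \<le> j \<and> j < n \<or> i = 1 \<and> j = n - 2 \<or> i = 2 \<and> j = n - 1" for i j
      using that nb[of j] at R(3,4) F'(4) by auto
    show "(us ! i, us ! j) \<in> parcs F" if "(i, j) \<in> parcs (S_two_one n)" for i j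
      using that e[of i j] F'(4)[OF e[of j i]] n unfolding S_two_one_simps(2)[OF n] Let_def by blast
  qed
qed

lemma contains_S_three:
  assumes F: "pair_graph F" and n: "5 \<le> n"
    and R: "(v, u) \<in> parcs F" "(u, x1) \<in> parcs F" "(u, x2) \<in> parcs F"
    and d: "distinct [v,u,x1,x2]" and c: "n - 3 \<le> card ({y. (v, y) \<in> parcs F} - {x1, x2})"
  shows "contains_copy F (S_three n)"
proof -
  have F': "u \<in> pverts F" "v \<in> pverts F" "u \<noteq> v" "(v, u) \<in> parcs F" if "(u, v) \<in> parcs F" for u v
    using F that unfolding pair_graph_iff by blast+
  let ?A = "{y. (v, y) \<in> parcs F} - {x1, x2}"
  have "?A \<subseteq> pverts F" using F' by auto
  moreover have "finite (pverts F)" using F by (simp add: pair_graph_iff)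
  ultimately have finA: "finite ?A" by (rule finite_subset)
  have "card (?A - {u}) = card ?A - 1" using R d finA by (simp add: card_Diff_subset)
  then have "n - 4 \<le> card (?A - {u})" using c by linarith
  then obtain zs where zs: "length zs = n - 4" "distinct zs" "set zs \<subseteq> ?A - {u}"
    using ex_distinct_list by blast
  \<comment> \<open>Positions 1 to \<open>n - 3\<close> hold the chosen neighbours of the centre,
    with \<open>u\<close> last, as the vertex \<open>n - 3\<close> of \<open>S_three n\<close> is
    the centre of the small star.\<close>
  define us where "us = [v] @ zs @ [u, x1, x2]"
  have len: "length us = n" using n zs by (simp add: us_def)
  have dist: "distinct us"
    using d zs F'(3) by (auto simp: us_def)
  have nb: "(v, us ! i) \<in> parcs F" if "1 \<le> i" "i \<le> n - 3" for i
  proof -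
    have l: "i - 1 < length (zs @ [u])" using that zs n by simp
    have "us ! i = ((zs @ [u]) @ [x1,x2]) ! (i - 1)" using that by (simp add: us_def)
    also have "\<dots> = (zs @ [u]) ! (i - 1)" unfolding nth_append using l by simp
    finally have "us ! i = (zs @ [u]) ! (i - 1)" .
    moreover note l
    ultimately have "us ! i \<in> set (zs @ [u])" by (metis nth_mem)
    then show ?thesis using zs(3) R by auto
  qed
  have at: "us ! 0 = v" "us ! (n - 3) = u" "us ! (n - 2) = x1" "us ! (n - 1) = x2"
  proof -
    show "us ! 0 = v" by (simp add: us_def)
    have l: "n - 3 = length (v # zs)" "n - 2 = length (v # zs) + 1" "n - 1 = length (v # zs) + 2"
      using n zs(1) by simp_all
    have us: "us = (v # zs) @ [u,x1,x2]" by (simp add: us_def)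
    show "us ! (n - 3) = u" "us ! (n - 2) = x1" "us ! (n - 1) = x2"
      unfolding us l nth_append_length nth_append_length_plus by simp_all
  qed
  have n4: "4 \<le> n" using n by simp
  show ?thesis
  proof (rule contains_copyI[OF F pair_graph_S_three[OF n4], of "\<lambda>i. us ! i"])
    show "inj_on ((!) us) (pverts (S_three n))"
      using dist len n by (simp add: S_three_simps inj_on_nth)
    have "set us \<subseteq> pverts F" using zs(3) R F' d by (auto simp: us_def)
    then show "(!) us ` pverts (S_three n) \<subseteq> pverts F"
      using len n by (auto simp: S_three_simps)
    have e: "(us ! i, us ! j) \<in> parcs F"
      if "i = 0 \<and> 1 \<le> j \<and> j \<le> n - 3 \<or> i = n - 3 \<and> (j = n - 2 \<or> j = n - 1)" for i j
      using that nb[of j] at R(2,3) by auto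
    show "(us ! i, us ! j) \<in> parcs F" if "(i, j) \<in> parcs (S_three n)" for i j
      using that e[of i j] F'(4)[OF e[of j i]] n unfolding S_three_simps(2)[OF n4] Let_def by blast
  qed
qed

section \<open>The lower bound and the two Ramsey numbers\<close>

lemma no_copy_in_cliques:
  assumes T: "pverts T = {..<n}" "\<And>i. i < n \<Longrightarrow> i \<noteq> 0 \<Longrightarrow> (0, i) \<in> parcs T \<or>
      (\<exists>j. (0, j) \<in> parcs T \<and> (j, i) \<in> parcs T)"
    and n: "0 < n" and m: "m \<le> 2 * (n - 1)"
    and F: "F = \<lparr> pverts = {..<m}, parcs = {(i, j). i < m \<and> j < m \<and> i \<noteq> j \<and>
        (i < n - 1 \<longleftrightarrow> j < n - 1)} \<rparr>"
  shows "\<not> contains_copy F (T :: nat pair_pre_digraph)"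
proof
  assume "contains_copy F T"
  then obtain f where f: "inj_on f (pverts T)" "f ` pverts T \<subseteq> pverts F"
    "\<forall>u v. (u, v) \<in> parcs T \<longrightarrow> (f u, f v) \<in> parcs F"
    by (rule contains_copyE)
  have e: "f u < n - 1 \<longleftrightarrow> f v < n - 1" if "(u, v) \<in> parcs T" for u v
    using f(3) that by (auto simp: F)
  \<comment> \<open>Every vertex of \<open>T\<close> is at most two edges away from
    \<open>0\<close>, so the image of \<open>T\<close> stays within one clique. Both cliques have at
    most \<open>n - 1\<close> vertices.\<close>
  have same: "f i < n - 1 \<longleftrightarrow> f 0 < n - 1" if "i < n" for i
    using T(2)[OF that] e by (cases "i = 0") blast+
  have "f ` {..<n} \<subseteq> (if f 0 < n - 1 then {..<n - 1} else {n - 1..<m})"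
  proof
    fix y assume "y \<in> f ` {..<n}"
    then obtain i where i: "i < n" "y = f i" by blast
    then have "y < m" using f(2) T(1) by (auto simp: F)
    then show "y \<in> (if f 0 < n - 1 then {..<n - 1} else {n - 1..<m})" using same[OF i(1)] i(2) by (cases "f 0 < n - 1") simp_all
  qed
  then have "card (f ` {..<n}) \<le> card (if f 0 < n - 1 then {..<n - 1} else {n - 1..<m})"
    by (intro card_mono) auto
  moreover have "card (f ` {..<n}) = n" using f(1) T(1) by (simp add: card_image)
  ultimately show False using n m by (auto split: if_splits)
qed

text \<open>The hub and two consecutive vertices of the rim form a triangle.\<close>

lemma no_wheel_in_bipartite:
  assumes B: "\<And>i j. (i, j) \<in> parcs F \<Longrightarrow> P i \<longleftrightarrow> \<not> P j"
  shows "\<not> contains_copy F (wheel_graph 8)"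
proof
  assume "contains_copy F (wheel_graph 8)"
  then obtain f where f: "\<forall>u v. (u, v) \<in> parcs (wheel_graph 8) \<longrightarrow> (f u, f v) \<in> parcs F"
    by (rule contains_copyE)
  have "(f 8, f 0) \<in> parcs F" "(f 8, f 1) \<in> parcs F" "(f 0, f 1) \<in> parcs F"
    by (rule f[rule_format], simp add: wheel_graph_simps)+
  then show False using B by blast
qed

text \<open>Since \<open>ramsey_number\<close> is a least element, each smaller \<open>m\<close>
  needs its own counterexample: the vertices below \<open>n - 1\<close> and those from
  \<open>n - 1\<close> on form two cliques, the second possibly empty.\<close>

lemma ramsey_numberI:
  assumes T: "pverts T = {..<n}" "\<And>i. i < n \<Longrightarrow> i \<noteq> 0 \<Longrightarrow> (0, i) \<in> parcs T \<or>
      (\<exists>j. (0, j) \<in> parcs T \<and> (j, i) \<in> parcs T)"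
    and n: "9 \<le> n"
    and up: "\<And>F :: nat pair_pre_digraph. pair_graph F \<Longrightarrow> card (pverts F) = 2 * n - 1 \<Longrightarrow>
       \<not> contains_copy F T \<Longrightarrow> \<not> contains_copy (complement_graph F) (wheel_graph 8) \<Longrightarrow> False"
  shows "ramsey_number (T :: nat pair_pre_digraph) (wheel_graph 8) = 2 * n - 1"
  unfolding ramsey_number_def
proof (rule Least_equality)
  show "0 < 2 * n - 1 \<and> (\<forall>F :: nat pair_pre_digraph. pair_graph F \<and> card (pverts F) = 2 * n - 1 \<longrightarrow>
     contains_copy F T \<or> contains_copy (complement_graph F) (wheel_graph 8))"
    using up n by auto
next
  fix m assume m: "0 < m \<and> (\<forall>F :: nat pair_pre_digraph. pair_graph F \<and> card (pverts F) = m \<longrightarrow>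
     contains_copy F T \<or> contains_copy (complement_graph F) (wheel_graph 8))"
  show "2 * n - 1 \<le> m"
  proof (rule ccontr)
    assume "\<not> ?thesis"
    then have le: "m \<le> 2 * (n - 1)" by simp
    define F :: "nat pair_pre_digraph" where
      "F = \<lparr> pverts = {..<m}, parcs = {(i, j). i < m \<and> j < m \<and> i \<noteq> j \<and>
        (i < n - 1 \<longleftrightarrow> j < n - 1)} \<rparr>"
    have "pair_graph F" "card (pverts F) = m" by (auto simp: pair_graph_iff F_def)
    then have "contains_copy F T \<or> contains_copy (complement_graph F) (wheel_graph 8)" using m by blast
    moreover have "\<not> contains_copy F T"
      by (rule no_copy_in_cliques[OF T _ le F_def]) (use n in simp_all)
    moreover have "\<not> contains_copy (complement_graph F) (wheel_graph 8)"
      by (rule no_wheel_in_bipartite[of _ "\<lambda>i. i < n - 1"]) (auto simp: complement_graph_def F_def)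
    ultimately show False by blast
  qed
qed

lemma co_wheel_free_pair_graph:
  assumes F: "pair_graph F" "card (pverts F) = 2 * n - 1" and n: "odd n" "9 \<le> n"
    and W: "\<not> contains_copy (complement_graph F) (wheel_graph 8)"
  shows "co_wheel_free (pverts F) (\<lambda>x y. (x, y) \<in> parcs F) n"
proof
  have co: "co_rel (pverts F) (\<lambda>x y. (x, y) \<in> parcs F) = (\<lambda>x y. (x, y) \<in> parcs (complement_graph F))"
    by (auto simp: co_rel_def complement_graph_def fun_eq_iff)
  show "\<not> has_c8 (co_rel (pverts F) (\<lambda>x y. (x, y) \<in> parcs F))
      {y. co_rel (pverts F) (\<lambda>x y. (x, y) \<in> parcs F) h y}" for h
    unfolding co using contains_wheel[OF pair_graph_complement[OF F(1)]] W by blast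
qed (use F n in \<open>auto simp: pair_graph_iff\<close>)

theorem theorem12:
  fixes n :: nat
  assumes "odd n" and "n \<ge> 9"
  shows "ramsey_number (S_two_one n) (wheel_graph 8) = 2 * n - 1 \<and>
         ramsey_number (S_three n) (wheel_graph 8) = 2 * n - 1"
proof
  show "ramsey_number (S_two_one n) (wheel_graph 8) = 2 * n - 1"
  proof (rule ramsey_numberI)
    show "pverts (S_two_one n) = {..<n}" using assms by (simp add: S_two_one_simps)
    show "(0, i) \<in> parcs (S_two_one n) \<or> (\<exists>j. (0, j) \<in> parcs (S_two_one n) \<and> (j, i) \<in> parcs (S_two_one n))"
      if i: "i < n" "i \<noteq> 0" for i
    proof -
      \<comment> \<open>The vertices from 3 on are adjacent to \<open>0\<close>; the vertices 1 and
        2 are reached through the subdividing vertices \<open>n - 2\<close> and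
        \<open>n - 1\<close>.\<close>
      consider "3 \<le> i" | "i = 1" | "i = 2" using i by linarith
      then show ?thesis
      proof cases
        case 2
        then show ?thesis using assms by (intro disjI2 exI[of _ "n - 2"]) (simp add: S_two_one_simps)
      next
        case 3
        then show ?thesis using assms by (intro disjI2 exI[of _ "n - 1"]) (simp add: S_two_one_simps)
      qed (use i assms in \<open>simp add: S_two_one_simps\<close>)
    qed
    fix F :: "nat pair_pre_digraph"
    assume F: "pair_graph F" "card (pverts F) = 2 * n - 1" "\<not> contains_copy F (S_two_one n)"
      "\<not> contains_copy (complement_graph F) (wheel_graph 8)"
    have "S_two_one_free (pverts F) (\<lambda>x y. (x, y) \<in> parcs F) n"
      using co_wheel_free_pair_graph[OF F(1,2) assms F(4)] contains_S_two_one[OF F(1)] F(3) assms(2)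
      by (auto simp: S_two_one_free_def S_two_one_free_axioms_def)
    then show False by (rule S_two_one_free.contradiction)
  qed (use assms in simp)
  show "ramsey_number (S_three n) (wheel_graph 8) = 2 * n - 1"
  proof (rule ramsey_numberI)
    show "pverts (S_three n) = {..<n}" using assms by (simp add: S_three_simps)
    show "(0, i) \<in> parcs (S_three n) \<or> (\<exists>j. (0, j) \<in> parcs (S_three n) \<and> (j, i) \<in> parcs (S_three n))"
      if "i < n" "i \<noteq> 0" for i
    proof (cases "i \<le> n - 3")
      case False
      then have "i = n - 2 \<or> i = n - 1" using that by linarith
      then show ?thesis using assms by (intro disjI2 exI[of _ "n - 3"]) (auto simp: S_three_simps)
    qed (use that assms in \<open>simp add: S_three_simps\<close>)
    fix F :: "nat pair_pre_digraph"
    assume F: "pair_graph F" "card (pverts F) = 2 * n - 1" "\<not> contains_copy F (S_three n)"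
      "\<not> contains_copy (complement_graph F) (wheel_graph 8)"
    have "S_three_free (pverts F) (\<lambda>x y. (x, y) \<in> parcs F) n"
      using co_wheel_free_pair_graph[OF F(1,2) assms F(4)] contains_S_three[OF F(1)] F(3) assms(2)
      by (auto simp: S_three_free_def S_three_free_axioms_def)
    then show False by (rule S_three_free.contradiction)
  qed (use assms in simp)
qed

end
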